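(* Let $\mathbb G$ be a step 2 Carnot group with CC distance $d$ and $d_0=d(\cdot,0)$. Let $g:\mathbb G\to\mathbb R$ be lower semicontinuous with $g(p)\ge -C(1+d_0(p))$ for all $p\in\mathbb G$ for some $C>0$. Define $$u(t,p)=\inf_{q\in\mathbb G}\Big\{g(q)+\frac{d(p,q)^2}{2t}\Big\},\qquad t>0,\ p\in\mathbb G$$ (the Hopf–Lax solution of $u_t+\tfrac12|\nabla_Hu|^2=0$, $u(0,\cdot)=g$). Then for every $t>0$, $u(t,\cdot)$ is h-semiconcave in $\mathbb G$.
   Context: A step 2 Carnot group is identified with $\mathbb R^n=\mathbb R^m\times\mathbb R^{n_2}$ with law $p\cdot q=(p^{(1)}+q^{(1)},p^{(2)}+q^{(2)}+\mathcal B(p^{(1)},q^{(1)}))$, $\mathcal B$ skew-symmetric bilinear, identity $0$, $p^{-1}=-p$; $X_1,\dots,X_m$ are the left-invariant fields equal to $\partial/\partial p_i$ at $0$, $\nabla_Hu=(X_1u,\dots,X_mu)$; CC distance $d(p,q)$ = infimum of $\int_0^1|u|$ over absolutely continuous curves from $p$ to $q$ with $\dot\gamma=\sum u_iX_i(\gamma)$ a.e. $\mathcal H_0=\mathbb R^m\times\{0\}$, $|\cdot|$ Euclidean norm. A lower semicontinuous function $v$ on $\mathbb G$ is h-semiconcave if there is $C'\ge0$ with $v(p\cdot h)+v(p\cdot h^{-1})-2v(p)\le C'|h|^2$ for all $p\in\mathbb G$, $h\in\mathcal H_0$. *)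

theory Defs
  imports "HOL-Analysis.Analysis"
begin

(* A step 2 Carnot group is modelled on (real^'m) \<times> (real^'k) (first layer R^m,
   second layer R^n2) with group law given by a bilinear skew-symmetric map B. *)

definition step2_carnot :: "(real^'m \<Rightarrow> real^'m \<Rightarrow> real^'k) \<Rightarrow> bool" where
  "step2_carnot B \<longleftrightarrow> bilinear B \<and> (\<forall>x y. B x y = - B y x)
      \<and> span (range (\<lambda>(x, y). B x y)) = UNIV"

definition gmult :: "(real^'m \<Rightarrow> real^'m \<Rightarrow> real^'k)
    \<Rightarrow> (real^'m) \<times> (real^'k) \<Rightarrow> (real^'m) \<times> (real^'k) \<Rightarrow> (real^'m) \<times> (real^'k)" where
  "gmult B p q = (fst p + fst q, snd p + snd q + B (fst p) (fst q))"

(* X_i(p) = (e_i, B(p^(1), e_i)); a curve gamma on [0,1] is horizontal with control u iff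
   u is (absolutely) integrable and gamma is absolutely continuous with
   gamma' = sum u_i X_i(gamma) a.e., i.e. gamma(t) - gamma(0) is the integral of
   (u, B(gamma^(1), u)) over [0,t]. *)
definition horizontal :: "(real^'m \<Rightarrow> real^'m \<Rightarrow> real^'k)
    \<Rightarrow> (real \<Rightarrow> (real^'m) \<times> (real^'k)) \<Rightarrow> (real \<Rightarrow> real^'m) \<Rightarrow> bool" where
  "horizontal B \<gamma> u \<longleftrightarrow> u absolutely_integrable_on {0..1} \<and>
     (\<forall>t\<in>{0..1}. ((\<lambda>s. (u s, B (fst (\<gamma> s)) (u s))) has_integral (\<gamma> t - \<gamma> 0)) {0..t})"

definition cc_dist :: "(real^'m \<Rightarrow> real^'m \<Rightarrow> real^'k)
    \<Rightarrow> (real^'m) \<times> (real^'k) \<Rightarrow> (real^'m) \<times> (real^'k) \<Rightarrow> real" where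
  "cc_dist B p q = Inf {integral {0..1} (\<lambda>s. norm (u s)) | \<gamma> u.
       horizontal B \<gamma> u \<and> \<gamma> 0 = p \<and> \<gamma> 1 = q}"

definition lsc :: "('a::topological_space \<Rightarrow> real) \<Rightarrow> bool" where
  "lsc v \<longleftrightarrow> (\<forall>a. open {x. a < v x})"

definition hopf_lax :: "(real^'m \<Rightarrow> real^'m \<Rightarrow> real^'k)
    \<Rightarrow> ((real^'m) \<times> (real^'k) \<Rightarrow> real) \<Rightarrow> real \<Rightarrow> (real^'m) \<times> (real^'k) \<Rightarrow> real" where
  "hopf_lax B g t p = (INF q. g q + (cc_dist B p q)\<^sup>2 / (2 * t))"

(* h in H_0 = R^m \<times> {0}, written (h1, 0); h^{-1} = -h = (-h1, 0); |h| = norm h1 *)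
definition h_semiconcave :: "(real^'m \<Rightarrow> real^'m \<Rightarrow> real^'k)
    \<Rightarrow> ((real^'m) \<times> (real^'k) \<Rightarrow> real) \<Rightarrow> bool" where
  "h_semiconcave B v \<longleftrightarrow> lsc v \<and> (\<exists>C'\<ge>0. \<forall>p h1.
      v (gmult B p (h1, 0)) + v (gmult B p (- h1, 0)) - 2 * v p \<le> C' * (norm h1)\<^sup>2)"

end

theory Submission
  imports Defs
begin

text \<open>
  The point is that the squared distance from the identity, \<open>e = d\<^sub>0\<^sup>2\<close>, is h-semiconcave; the Hopf-Lax
  infimum then inherits the property, the constant being divided by \<open>2 t\<close>.

  Write \<open>e\<close> as the infimum of the energy \<open>N \<Sum> |\<xi>\<^sub>j|\<^sup>2\<close> over polygons with increments \<open>\<xi>\<^sub>j\<close>, \<open>j < N\<close>. Small loops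
  which do not interact with a given polygon show that changing the endpoint vertically by \<open>z\<close> costs
  at most a multiple of \<open>|z|\<close>. By this Lipschitz bound, a nearly minimal polygon satisfies the
  Euler-Lagrange equation \<open>\<xi>\<^sub>j = \<mu> + \<Lambda> M\<^sub>j\<close> (\<open>\<Lambda>\<close> skew, \<open>M\<^sub>j\<close> the midpoints) up to a small error, even
  in the presence of abnormal minimisers. Hence its vertices are nearly an orbit \<open>X\<^sub>0 = 0, X\<^sub>1, \<dots>\<close> of an
  affine isometry. As in Turan's lemma, such an orbit satisfies \<open>\<Sum> \<phi>\<^sub>j X\<^sub>j = 0\<close>, \<open>\<Sum> \<phi>\<^sub>j = 1\<close> with
  \<open>N \<Sum> \<phi>\<^sub>j\<^sup>2\<close> bounded in terms of the dimension only. The polygons with increments \<open>\<xi>\<^sub>j \<plusminus> \<phi>\<^sub>j h\<close> then reach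
  the two translated points up to a small vertical error, and their energies add up to
  \<open>2 N \<Sum> |\<xi>\<^sub>j|\<^sup>2 + 2 N \<Sum> \<phi>\<^sub>j\<^sup>2 |h|\<^sup>2\<close>.
\<close>

section \<open>Orbits of affine isometries\<close>

text \<open>The Rayleigh quotient attains its maximum on the compact unit sphere of
  \<open>V\<close>. At a maximiser \<open>e\<close> the residual
  \<open>w = s *\<^sub>R e - S e\<close> lies in \<open>V\<close>, and moving \<open>e\<close> along
  \<open>- w\<close> would increase the quotient unless \<open>w = 0\<close>.\<close>

lemma selfadjoint_eigenvector_in_subspace:
  fixes S :: "'a::euclidean_space \<Rightarrow> 'a"
  assumes lin: "linear S" and sa: "\<And>x y. S x \<bullet> y = x \<bullet> S y"
    and V: "subspace V" and inv: "\<And>x. x \<in> V \<Longrightarrow> S x \<in> V" and ne: "V \<noteq> {0}"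
  obtains e s where "e \<in> V" "norm e = 1" "S e = s *\<^sub>R e"
proof -
  have comp: "compact (V \<inter> sphere 0 1)"
    by (simp add: closed_Int_compact closed_subspace V)
  obtain v where v: "v \<in> V" "v \<noteq> 0" using ne subspace_0[OF V] by blast
  then have "v /\<^sub>R norm v \<in> V \<inter> sphere 0 1"
    using V by (simp add: subspace_scale)
  then have ne': "V \<inter> sphere 0 1 \<noteq> {}" by blast
  have "continuous_on (V \<inter> sphere 0 1) (\<lambda>x. S x \<bullet> x)"
    by (intro continuous_intros linear_continuous_on) (simp add: lin linear_conv_bounded_linear[symmetric])
  from continuous_attains_sup[OF comp ne' this]
  obtain e where e: "e \<in> V" "norm e = 1"
    and mx: "\<And>y. y \<in> V \<Longrightarrow> norm y = 1 \<Longrightarrow> S y \<bullet> y \<le> S e \<bullet> e"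
    by auto
  define s where "s = S e \<bullet> e"
  interpret S: linear S by (rule lin)
  have Q: "S y \<bullet> y \<le> s * (y \<bullet> y)" if "y \<in> V" for y
  proof (cases "y = 0")
    case True then show ?thesis by (simp add: S.zero)
  next
    case False
    have "S (y /\<^sub>R norm y) \<bullet> (y /\<^sub>R norm y) \<le> s"
      unfolding s_def using False that V by (intro mx) (auto simp: subspace_scale)
    then have "S y \<bullet> y / (norm y)\<^sup>2 \<le> s"
      using False by (simp add: S.scaleR power2_eq_square divide_inverse mult_ac)
    then show ?thesis
      using False by (simp add: divide_le_eq power2_norm_eq_inner)
  qed
  define w where "w = s *\<^sub>R e - S e"
  have w: "w \<in> V" unfolding w_def
    using e inv V by (intro subspace_diff subspace_scale) auto
  have ee: "e \<bullet> e = 1" using e(2) by (simp add: dot_square_norm)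
  have quad: "0 \<le> 2 * t * (w \<bullet> w) + t\<^sup>2 * (s * (w \<bullet> w) - S w \<bullet> w)" for t
  proof -
    have "S (e + t *\<^sub>R w) \<bullet> (e + t *\<^sub>R w) \<le> s * ((e + t *\<^sub>R w) \<bullet> (e + t *\<^sub>R w))"
      using e w V by (intro Q subspace_add subspace_scale) auto
    moreover have "S w \<bullet> e = S e \<bullet> w" by (metis sa inner_commute)
    moreover have "S (e + t *\<^sub>R w) \<bullet> (e + t *\<^sub>R w)
        = s + t * (S e \<bullet> w) + t * (S w \<bullet> e) + t\<^sup>2 * (S w \<bullet> w)"
      by (simp add: S.add S.scaleR inner_add_left inner_add_right power2_eq_square s_def algebra_simps)
    moreover have "(e + t *\<^sub>R w) \<bullet> (e + t *\<^sub>R w) = 1 + 2 * t * (e \<bullet> w) + t\<^sup>2 * (w \<bullet> w)"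
      by (simp add: inner_add_left inner_add_right power2_eq_square ee inner_commute[of w e] algebra_simps)
    ultimately have le: "s + 2 * t * (S e \<bullet> w) + t\<^sup>2 * (S w \<bullet> w)
        \<le> s * (1 + 2 * t * (e \<bullet> w) + t\<^sup>2 * (w \<bullet> w))"
      by simp
    have ww: "w \<bullet> w = s * (e \<bullet> w) - S e \<bullet> w"
      by (metis inner_diff_left inner_scaleR_left w_def)
    have "2 * t * (w \<bullet> w) = 2 * t * (s * (e \<bullet> w) - S e \<bullet> w)" by (simp only: ww)
    also have "\<dots> = s * (1 + 2 * t * (e \<bullet> w)) - (s + 2 * t * (S e \<bullet> w))"
      by (simp add: algebra_simps)
    finally show ?thesis using le by (simp add: distrib_left right_diff_distrib mult.left_commute)
  qed
  have "w \<bullet> w = 0"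
  proof (rule ccontr)
    assume nz: "w \<bullet> w \<noteq> 0"
    define a where "a = w \<bullet> w"
    define b where "b = s * (w \<bullet> w) - S w \<bullet> w"
    have a: "a > 0" using nz by (simp add: a_def)
    \<comment> \<open>A step backwards along \<open>w\<close>, so short that the linear term
      \<open>2 * t * a\<close> outweighs \<open>t\<^sup>2 * b\<close>.\<close>
    define t where "t = - a / (\<bar>b\<bar> + 1)"
    have "t < 0" using a by (simp add: t_def divide_neg_pos)
    have "2 * t * a + t\<^sup>2 * b = t * (2 * a + t * b)" by (simp add: power2_eq_square algebra_simps)
    moreover have "\<bar>t * b\<bar> \<le> a"
    proof -
      have "\<bar>t * b\<bar> = a * (\<bar>b\<bar> / (\<bar>b\<bar> + 1))" using a by (simp add: t_def abs_mult)
      also have "\<dots> \<le> a * 1" using a by (intro mult_left_mono) auto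
      finally show ?thesis by simp
    qed
    then have "2 * a + t * b > 0" using a by linarith
    ultimately have "2 * t * a + t\<^sup>2 * b < 0" using \<open>t < 0\<close> by (simp add: mult_neg_pos)
    with quad[of t] show False by (simp add: a_def b_def)
  qed
  then have "S e = s *\<^sub>R e" by (simp add: w_def)
  with e that show ?thesis by blast
qed

text \<open>The coefficients come from \<open>\<Prod>(z\<^sup>2 - s z + 1)\<close>, where \<open>s \<in> [-2, 2]\<close> runs through the eigenvalues of
  the self-adjoint operator \<open>P + P\<^sup>*\<close>; their bound does not depend on the isometry \<open>P\<close>.\<close>
lemma isometry_annihilating_combination:
  fixes P :: "'a::euclidean_space \<Rightarrow> 'a"
  assumes lin: "linear P" and iso: "\<And>x. norm (P x) = norm x"
    and V: "subspace V" and inv: "\<And>x. x \<in> V \<Longrightarrow> P x + adjoint P x \<in> V" and dim: "dim V \<le> n"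
    and v: "v \<in> V"
  shows "\<exists>\<beta>::nat \<Rightarrow> real. \<beta> 0 = 1 \<and> (\<forall>i. \<bar>\<beta> i\<bar> \<le> 4 ^ n) \<and> (\<forall>i>2*n. \<beta> i = 0)
    \<and> (\<Sum>i\<le>2*n. \<beta> i *\<^sub>R (P ^^ i) v) = 0"
  using V inv dim v
proof (induction n arbitrary: V v)
  case 0
  then have "v = 0" by auto
  then show ?case by (intro exI[of _ "\<lambda>i. if i = 0 then 1 else 0"]) auto
next
  case (Suc n)
  interpret P: linear P by (rule lin)
  note adj = adjoint_works[OF lin]
  have linA: "linear (adjoint P)" by (rule adjoint_linear[OF lin])
  interpret A: linear "adjoint P" by (rule linA)
  have ot: "orthogonal_transformation P"
    using lin iso by (simp add: orthogonal_transformation)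
  have inner_P: "P x \<bullet> P y = x \<bullet> y" for x y
    using ot by (simp add: orthogonal_transformation_def)
  have AP: "adjoint P (P x) = x" for x
  proof -
    have "y \<bullet> adjoint P (P x) = y \<bullet> x" for y by (simp add: adj inner_P)
    then show ?thesis by (metis vector_eq_ldot)
  qed
  have PA: "P (adjoint P x) = x" for x
  proof -
    obtain y where "x = P y" using orthogonal_transformation_surj[OF ot] by (metis surj_def)
    then show ?thesis by (simp add: AP)
  qed
  \<comment> \<open>For an isometry \<open>adjoint P\<close> is the inverse of \<open>P\<close>, so
    \<open>P\<close> composed with \<open>S - s\<close> is \<open>P\<^sup>2 - s P + 1\<close>. This
    is the factor contributed by an eigenvalue \<open>s\<close> of \<open>S\<close>.\<close>
  define S where "S x = P x + adjoint P x" for x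
  have linS: "linear S" unfolding S_def using lin linA by (rule linear_compose_add)
  interpret S: linear S by (rule linS)
  have saS: "S x \<bullet> y = x \<bullet> S y" for x y
    unfolding S_def inner_add_left inner_add_right using adj by (metis add.commute inner_commute)
  have invS: "S x \<in> V" if "x \<in> V" for x using Suc.prems(2) that by (simp add: S_def)
  show ?case
  proof (cases "V = {0}")
    case True
    then have "v = 0" using Suc.prems by auto
    moreover have "(P ^^ i) 0 = 0" for i by (induction i) (auto simp: P.zero)
    moreover have "(1::real) \<le> 4 * 4 ^ n" using one_le_power[of "4::real" "Suc n"] by simp
    ultimately show ?thesis
      by (intro exI[of _ "\<lambda>i. if i = 0 then 1 else 0"]) (simp del: sum.atMost_Suc mult_Suc_right)
  next
    case False
    obtain e s where e: "e \<in> V" "norm e = 1" and Se: "S e = s *\<^sub>R e"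
      by (rule selfadjoint_eigenvector_in_subspace[OF linS saS Suc.prems(1) invS False]) auto
    have "\<bar>s\<bar> = norm (S e)" using e Se by simp
    also have "\<dots> \<le> norm (P e) + norm (adjoint P e)" unfolding S_def by (rule norm_triangle_ineq)
    also have "\<dots> = 2" using e iso[of e] iso[of "adjoint P e"] by (simp add: PA)
    finally have s: "\<bar>s\<bar> \<le> 2" .
    \<comment> \<open>Splitting off \<open>e\<close> lowers the dimension. By self-adjointness
      \<open>S - s\<close> maps \<open>V\<close> into the complement of \<open>e\<close>, so the
      induction hypothesis applies to \<open>v1\<close> below.\<close>
    define V' where "V' = V \<inter> {x. e \<bullet> x = 0}"
    have V': "subspace V'" unfolding V'_def
      by (intro subspace_inter Suc.prems(1) subspace_hyperplane)
    have invV': "P x + adjoint P x \<in> V'" if "x \<in> V'" for x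
    proof -
      have "e \<bullet> S x = 0" using that saS[of e x] Se by (simp add: V'_def)
      then show ?thesis using that invS by (auto simp: V'_def S_def)
    qed
    have "e \<notin> V'" using e by (auto simp: V'_def)
    then have "V' \<subset> V" using e unfolding V'_def by blast
    then have "dim V' < dim V"
      by (metis V' Suc.prems(1) dim_psubset span_eq_iff)
    then have dimV': "dim V' \<le> n" using Suc.prems(3) by linarith
    define v1 where "v1 = S v - s *\<^sub>R v"
    have "e \<bullet> v1 = 0" using saS[of e v] Se by (simp add: v1_def inner_diff_right)
    then have "v1 \<in> V'" unfolding V'_def v1_def
      using Suc.prems(1,4) invS by (auto intro: subspace_diff subspace_scale)
    from Suc.IH[OF V' invV' dimV' this]
    obtain \<beta> where \<beta>: "\<beta> 0 = 1" "\<And>i. \<bar>\<beta> i\<bar> \<le> 4 ^ n" "\<And>i. i > 2*n \<Longrightarrow> \<beta> i = 0"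
      and sum0: "(\<Sum>i\<le>2*n. \<beta> i *\<^sub>R (P ^^ i) v1) = 0" by blast
    define w where "w i = (P ^^ i) v" for i
    have linPi: "linear (P ^^ i)" for i
      by (induction i) (auto simp: linear_iff P.add P.scaleR)
    \<comment> \<open>Applying \<open>P\<close> once more clears the inverse contained in
      \<open>v1\<close>, so that only nonnegative powers of \<open>P\<close> remain.\<close>
    have step: "P ((P ^^ i) v1) = w i - s *\<^sub>R w (i+1) + w (i+2)" for i
    proof -
      have "P ((P ^^ i) v1) = (P ^^ i) (P v1)" by (simp add: funpow_swap1)
      also have "P v1 = v - s *\<^sub>R P v + P (P v)"
        by (simp add: v1_def S_def P.diff P.add P.scaleR PA)
      also have "(P ^^ i) \<dots> = w i - s *\<^sub>R w (i+1) + w (i+2)"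
        using linPi[of i] by (simp add: w_def linear_add linear_diff linear_scale funpow_swap1)
      finally show ?thesis .
    qed
    have "0 = P (\<Sum>i\<le>2*n. \<beta> i *\<^sub>R (P ^^ i) v1)" by (simp add: sum0 P.zero)
    also have "\<dots> = (\<Sum>i\<le>2*n. \<beta> i *\<^sub>R (w i - s *\<^sub>R w (i+1) + w (i+2)))"
      by (simp only: P.sum P.scaleR step)
    also have "\<dots> = (\<Sum>i\<le>2*n. \<beta> i *\<^sub>R w i) - s *\<^sub>R (\<Sum>i\<le>2*n. \<beta> i *\<^sub>R w (Suc i))
         + (\<Sum>i\<le>2*n. \<beta> i *\<^sub>R w (Suc (Suc i)))"
      by (simp add: sum.distrib sum_subtractf algebra_simps scaleR_sum_right)
    finally have zero: "(\<Sum>i\<le>2*n. \<beta> i *\<^sub>R w i) - s *\<^sub>R (\<Sum>i\<le>2*n. \<beta> i *\<^sub>R w (Suc i))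
         + (\<Sum>i\<le>2*n. \<beta> i *\<^sub>R w (Suc (Suc i))) = 0" by simp
    \<comment> \<open>\<open>\<beta>1\<close> and \<open>\<beta>2\<close> are \<open>\<beta>\<close>
      shifted by one and two places, so \<open>\<gamma>\<close> lists the coefficients of the
      product with \<open>1 - s z + z\<^sup>2\<close>. Since \<open>\<bar>s\<bar> \<le> 2\<close>,
      the bound grows by the factor 1 + 2 + 1 = 4.\<close>
    define \<beta>1 where "\<beta>1 i = (case i of 0 \<Rightarrow> 0 | Suc j \<Rightarrow> \<beta> j)" for i
    define \<beta>2 where "\<beta>2 i = (case i of 0 \<Rightarrow> 0 | Suc j \<Rightarrow> \<beta>1 j)" for i
    define \<gamma> where "\<gamma> i = \<beta> i - s * \<beta>1 i + \<beta>2 i" for i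
    have b1: "\<bar>\<beta>1 i\<bar> \<le> 4 ^ n" for i by (simp add: \<beta>1_def \<beta>(2) split: nat.split)
    have b2: "\<bar>\<beta>2 i\<bar> \<le> 4 ^ n" for i by (simp add: \<beta>2_def b1 split: nat.split)
    have e0: "(\<Sum>i\<le>2 * Suc n. \<beta> i *\<^sub>R w i) = (\<Sum>i\<le>2*n. \<beta> i *\<^sub>R w i)"
      by (simp add: \<beta>(3))
    have e1: "(\<Sum>i\<le>2 * Suc n. \<beta>1 i *\<^sub>R w i) = (\<Sum>i\<le>2*n. \<beta> i *\<^sub>R w (Suc i))"
      using sum.atMost_Suc_shift[of "\<lambda>i. \<beta>1 i *\<^sub>R w i" "Suc (2 * n)"] by (simp add: \<beta>1_def \<beta>(3))
    have e2: "(\<Sum>i\<le>2 * Suc n. \<beta>2 i *\<^sub>R w i) = (\<Sum>i\<le>2*n. \<beta> i *\<^sub>R w (Suc (Suc i)))"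
      by (simp add: sum.atMost_Suc_shift \<beta>2_def \<beta>1_def del: sum.atMost_Suc)
    show ?thesis
    proof (intro exI[of _ \<gamma>] conjI allI impI)
      show "\<gamma> 0 = 1" by (simp add: \<gamma>_def \<beta>1_def \<beta>2_def \<beta>(1))
      show "\<bar>\<gamma> i\<bar> \<le> 4 ^ Suc n" for i
      proof -
        have "\<bar>s * \<beta>1 i\<bar> \<le> 2 * 4 ^ n" unfolding abs_mult using s b1 by (intro mult_mono) auto
        then show ?thesis using \<beta>(2)[of i] b2[of i] unfolding \<gamma>_def by simp
      qed
      show "\<gamma> i = 0" if "2 * Suc n < i" for i
        using that \<beta>(3) by (auto simp: \<gamma>_def \<beta>1_def \<beta>2_def split: nat.split)
      have "(\<Sum>i\<le>2 * Suc n. \<gamma> i *\<^sub>R w i) = (\<Sum>i\<le>2 * Suc n. \<beta> i *\<^sub>R w i)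
          - s *\<^sub>R (\<Sum>i\<le>2 * Suc n. \<beta>1 i *\<^sub>R w i) + (\<Sum>i\<le>2 * Suc n. \<beta>2 i *\<^sub>R w i)"
        by (simp add: \<gamma>_def sum.distrib sum_subtractf scaleR_sum_right algebra_simps del: sum.atMost_Suc mult_Suc_right)
      then have "(\<Sum>i\<le>2 * Suc n. \<gamma> i *\<^sub>R w i) = 0" by (simp only: e0 e1 e2 zero)
      then show "(\<Sum>i\<le>2 * Suc n. \<gamma> i *\<^sub>R (P ^^ i) v) = 0" by (simp only: w_def)
    qed
  qed
qed

text \<open>The increments of the orbit are \<open>(P ^^ k) b\<close> and satisfy the relation with
  coefficients \<open>\<beta>\<close>. Summation by parts turns it into a relation between the
  points, with coefficients \<open>\<beta> i - \<beta> (Suc i)\<close>; these telescope to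
  \<open>\<beta> 0 = 1\<close>, and the boundary term vanishes with \<open>\<beta>\<close> beyond
  twice the dimension.\<close>

lemma affine_isometry_orbit_combination:
  fixes P :: "'a::euclidean_space \<Rightarrow> 'a"
  assumes lin: "linear P" and iso: "\<And>x. norm (P x) = norm x"
    and X0: "X 0 = 0" and XS: "\<And>k. X (Suc k) = P (X k) + b"
  shows "\<exists>c::nat \<Rightarrow> real. (\<Sum>i<2 * DIM('a) + 1. c i) = 1 \<and> (\<forall>i. \<bar>c i\<bar> \<le> 2 * 4 ^ DIM('a))
    \<and> (\<Sum>i<2 * DIM('a) + 1. c i *\<^sub>R X (Suc i)) = 0"
proof -
  interpret P: linear P by (rule lin)
  let ?n = "DIM('a)"
  have "dim (UNIV :: 'a set) \<le> ?n" by simp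
  from isometry_annihilating_combination[OF lin iso subspace_UNIV _ this, of b]
  obtain \<beta> where \<beta>: "\<beta> 0 = 1" "\<And>i. \<bar>\<beta> i\<bar> \<le> 4 ^ ?n" "\<And>i. i > 2*?n \<Longrightarrow> \<beta> i = 0"
    and sum0: "(\<Sum>i\<le>2*?n. \<beta> i *\<^sub>R (P ^^ i) b) = 0" by auto
  have D: "X (Suc k) - X k = (P ^^ k) b" for k
  proof (induction k)
    case 0 then show ?case by (simp add: XS X0 P.zero)
  next
    case (Suc k)
    have "X (Suc (Suc k)) - X (Suc k) = P (X (Suc k) - X k)"
      by (simp add: XS[of "Suc k"] XS[of k] P.diff)
    then show ?case by (simp add: Suc)
  qed
  define c where "c i = \<beta> i - \<beta> (Suc i)" for i
  have "(\<Sum>i<k. c i) = \<beta> 0 - \<beta> k" for k by (induction k) (auto simp: c_def)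
  from this[of "2 * ?n + 1"] have s1: "(\<Sum>i<2 * ?n + 1. c i) = 1" by (simp only: \<beta>)
  have c: "\<bar>c i\<bar> \<le> 2 * 4 ^ ?n" for i using \<beta>(2)[of i] \<beta>(2)[of "Suc i"] by (simp add: c_def)
  have "(\<Sum>i<k. c i *\<^sub>R X (Suc i)) = (\<Sum>i<k. \<beta> i *\<^sub>R (X (Suc i) - X i)) - \<beta> k *\<^sub>R X k" for k
    by (induction k) (auto simp: c_def X0 algebra_simps)
  from this[of "Suc (2 * ?n)"] have "(\<Sum>i<2 * ?n + 1. c i *\<^sub>R X (Suc i)) = 0"
    using sum0 \<beta>(3)[of "Suc (2 * ?n)"] by (simp add: D lessThan_Suc_atMost del: sum.lessThan_Suc)
  with s1 c show ?thesis by blast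
qed

text \<open>Solving the implicit midpoint rule for the next point gives the Cayley transform of
  \<open>\<Lambda>\<close>, that is \<open>1 + \<Lambda>/2\<close> followed by the inverse of
  \<open>1 - \<Lambda>/2\<close>. The inverse exists because
  \<open>f v \<bullet> v = v \<bullet> v\<close>.\<close>

lemma skew_midpoint_recursion:
  fixes \<Lambda> :: "'a::euclidean_space \<Rightarrow> 'a"
  assumes lin: "linear \<Lambda>" and skew: "\<And>v. \<Lambda> v \<bullet> v = 0"
  shows "\<exists>P b. linear P \<and> (\<forall>x. norm (P x) = norm x) \<and>
    (\<forall>x. P x + b - x = \<mu> + \<Lambda> ((1/2) *\<^sub>R (x + (P x + b))))"
proof -
  interpret \<Lambda>: linear \<Lambda> by (rule lin)
  define f where "f v = v - (1/2) *\<^sub>R \<Lambda> v" for v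
  have linf: "linear f" unfolding f_def
    by (intro linearI) (simp_all add: \<Lambda>.add \<Lambda>.scaleR algebra_simps)
  have "inj f"
  proof (rule linear_injective_0[OF linf, THEN iffD2], intro allI impI)
    fix v assume "f v = 0"
    then have "f v \<bullet> v = 0" by simp
    then show "v = 0" by (simp add: f_def inner_diff_left skew)
  qed
  then obtain g where g: "linear g" "\<And>x. g (f x) = x" "\<And>x. f (g x) = x"
    using linear_injective_isomorphism[OF linf] by auto
  define P where "P v = g (v + (1/2) *\<^sub>R \<Lambda> v)" for v
  have "linear (\<lambda>v. v + (1/2) *\<^sub>R \<Lambda> v)"
    by (intro linearI) (simp_all add: \<Lambda>.add \<Lambda>.scaleR algebra_simps)
  from linear_compose[OF this g(1)] have linP: "linear P" by (simp add: P_def[abs_def] o_def)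
  have P: "P v - (1/2) *\<^sub>R \<Lambda> (P v) = v + (1/2) *\<^sub>R \<Lambda> v" for v
    using g(3)[of "v + (1/2) *\<^sub>R \<Lambda> v"] by (simp add: P_def f_def)
  have iso: "norm (P v) = norm v" for v
  proof -
    have "P v - v = (1/2) *\<^sub>R \<Lambda> (P v + v)" using P[of v] by (simp add: \<Lambda>.add algebra_simps)
    then have "(P v - v) \<bullet> (P v + v) = 0" by (simp add: skew)
    then have "P v \<bullet> P v = v \<bullet> v" by (simp add: inner_diff_left inner_add_right inner_commute[of v "P v"])
    then show ?thesis by (simp add: norm_eq_sqrt_inner)
  qed
  have b: "g \<mu> - (1/2) *\<^sub>R \<Lambda> (g \<mu>) = \<mu>" using g(3)[of \<mu>] by (simp add: f_def)
  have "P x + g \<mu> - x = \<mu> + \<Lambda> ((1/2) *\<^sub>R (x + (P x + g \<mu>)))" for x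
  proof -
    have "P x = x + (1/2) *\<^sub>R \<Lambda> x + (1/2) *\<^sub>R \<Lambda> (P x)" "g \<mu> = \<mu> + (1/2) *\<^sub>R \<Lambda> (g \<mu>)"
      using P[of x] b by (simp_all add: algebra_simps)
    then have "P x + g \<mu> - x = (1/2) *\<^sub>R \<Lambda> x + (1/2) *\<^sub>R \<Lambda> (P x) + (\<mu> + (1/2) *\<^sub>R \<Lambda> (g \<mu>))"
      by (metis (no_types, lifting) add.assoc add.commute add_diff_cancel_right')
    then show ?thesis by (simp add: \<Lambda>.add \<Lambda>.scaleR scaleR_add_right add_ac)
  qed
  with linP iso show ?thesis by blast
qed

text \<open>Pairing the recursion with \<open>d + d'\<close> removes the skew term. Errors therefore
  only add up, however large \<open>\<Lambda>\<close> is; this matters because the multipliers found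
  later come without any bound.\<close>

lemma midpoint_recursion_stability:
  assumes skew: "\<And>v. \<Lambda> v \<bullet> v = 0"
    and eq: "d' - d = \<Lambda> ((1/2) *\<^sub>R (d + d')) + r"
  shows "norm d' \<le> norm d + norm (r :: 'a::real_inner)"
proof -
  have "\<Lambda> ((1/2) *\<^sub>R (d + d')) \<bullet> (d + d') = 0" using skew[of "(1/2) *\<^sub>R (d + d')"] by simp
  then have "(d' - d) \<bullet> (d + d') = r \<bullet> (d + d')" unfolding eq by (simp add: inner_add_left)
  also have "\<dots> \<le> norm r * norm (d + d')" by (rule norm_cauchy_schwarz)
  also have "\<dots> \<le> norm r * (norm d + norm d')" by (intro mult_left_mono norm_triangle_ineq) auto
  finally have "(d' - d) \<bullet> (d + d') \<le> norm r * (norm d + norm d')" .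
  moreover have "(d' - d) \<bullet> (d + d') = (norm d' - norm d) * (norm d + norm d')"
    by (simp add: inner_diff_left inner_add_right inner_commute[of d' d] dot_square_norm power2_eq_square left_diff_distrib distrib_left)
  ultimately have *: "(norm d' - norm d) * (norm d + norm d') \<le> norm r * (norm d + norm d')" by simp
  show ?thesis
  proof (cases "norm d + norm d' = 0")
    case True then show ?thesis using norm_ge_zero[of d] norm_ge_zero[of r] norm_ge_zero[of d'] by linarith
  next
    case False
    then have "norm d + norm d' > 0" using norm_ge_zero[of d] norm_ge_zero[of d'] by linarith
    with * show ?thesis by (simp add: mult_le_cancel_right)
  qed
qed

text \<open>Averages the relations of \<open>affine_isometry_orbit_combination\<close> along the subsequences
  \<open>X 0, X t, X (2 t), \<dots>\<close> over the step lengths \<open>t\<close>, which spreads out the weights.\<close>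
lemma spread_orbit_combination:
  fixes P :: "'a::euclidean_space \<Rightarrow> 'a"
  assumes lin: "linear P" and iso: "\<And>x. norm (P x) = norm x"
    and X0: "X 0 = 0" and XS: "\<And>k. X (Suc k) = P (X k) + b"
    and n: "n = 2 * DIM('a) + 1" and c: "c = 2 * 4 ^ DIM('a)" and N: "n < N"
  shows "\<exists>\<phi>::nat \<Rightarrow> real. (\<Sum>j<N. \<phi> j) = 1 \<and> (\<Sum>j<N. \<phi> j *\<^sub>R X j) = 0 \<and>
    (\<Sum>j<N. \<bar>\<phi> j\<bar>) \<le> real n * c \<and> real N * (\<Sum>j<N. (\<phi> j)\<^sup>2) \<le> 2 * real n ^ 3 * c\<^sup>2"
proof -
  interpret P: linear P by (rule lin)
  have c0: "c > 0" and n0: "n > 0" by (simp_all add: c n)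
  have sub: "X (k + t) = (P ^^ t) (X k) + X t" for k t
  proof (induction t)
    case (Suc t)
    have "X (k + Suc t) = P ((P ^^ t) (X k) + X t) + b" using Suc XS[of "k + t"] by simp
    then show ?case by (simp add: P.add XS[of t])
  qed (simp add: X0)
  have linPt: "linear (P ^^ t)" for t by (induction t) (auto simp: linear_iff P.add P.scaleR)
  have isoPt: "norm ((P ^^ t) x) = norm x" for t x by (induction t) (auto simp: iso)
  have "\<forall>t. \<exists>a::nat \<Rightarrow> real. (\<Sum>i<n. a i) = 1 \<and> (\<forall>i. \<bar>a i\<bar> \<le> c) \<and> (\<Sum>i<n. a i *\<^sub>R X (Suc i * t)) = 0"
  proof
    fix t
    have "X (Suc k * t) = (P ^^ t) (X (k * t)) + X t" for k
      using sub[of "k * t" t] by (simp add: add.commute)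
    then show "\<exists>a::nat \<Rightarrow> real. (\<Sum>i<n. a i) = 1 \<and> (\<forall>i. \<bar>a i\<bar> \<le> c) \<and> (\<Sum>i<n. a i *\<^sub>R X (Suc i * t)) = 0"
      using affine_isometry_orbit_combination[OF linPt isoPt, of "\<lambda>k. X (k * t)" t "X t"] X0
      unfolding n c by simp
  qed
  then obtain a :: "nat \<Rightarrow> nat \<Rightarrow> real" where a1: "\<And>t. (\<Sum>i<n. a t i) = 1" and ac: "\<And>t i. \<bar>a t i\<bar> \<le> c"
    and a0: "\<And>t. (\<Sum>i<n. a t i *\<^sub>R X (Suc i * t)) = 0" by metis
  \<comment> \<open>The largest number of step lengths for which all indices
    \<open>Suc i * t\<close> stay below \<open>N\<close>; it is comparable to
    \<open>N\<close>.\<close>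
  define T where "T = (N - 1) div n"
  have T1: "T \<ge> 1" using N n0 unfolding T_def by (simp add: Suc_le_eq div_greater_zero_iff)
  have "n * T \<le> N - 1" unfolding T_def by (rule times_div_less_eq_dividend)
  then have nT: "n * T < N" using N by linarith
  have NT: "N \<le> 2 * n * T"
  proof -
    have "N - 1 = n * T + (N - 1) mod n" unfolding T_def by (rule mult_div_mod_eq[symmetric])
    then have "N - 1 < n * T + n" using mod_less_divisor[OF n0, of "N - 1"] by linarith
    moreover have "n \<le> n * T" using T1 by simp
    ultimately show ?thesis by linarith
  qed
  \<comment> \<open>The mean over \<open>t\<close> of the relations for step length
    \<open>t\<close>, collected by the index \<open>j\<close> of the orbit point.\<close>
  define \<phi> where "\<phi> j = (\<Sum>t=1..T. \<Sum>i<n. if Suc i * t = j then a t i else 0) / real T" for j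
  have idx: "Suc i * t < N" if "i < n" "t \<in> {1..T}" for i t
  proof -
    have "Suc i * t \<le> n * T" using that by (intro mult_le_mono) auto
    then show ?thesis using nT by linarith
  qed
  have sum_f: "(\<Sum>j<N. \<phi> j *\<^sub>R f j) = (1 / real T) *\<^sub>R (\<Sum>t=1..T. \<Sum>i<n. a t i *\<^sub>R f (Suc i * t))"
    for f :: "nat \<Rightarrow> 'c::real_vector"
  proof -
    have "(\<Sum>j<N. \<phi> j *\<^sub>R f j)
        = (1 / real T) *\<^sub>R (\<Sum>j<N. \<Sum>t=1..T. \<Sum>i<n. if Suc i * t = j then a t i *\<^sub>R f j else 0)"
      unfolding scaleR_sum_right \<phi>_def
      by (intro sum.cong refl) (simp add: scaleR_sum_left sum_divide_distrib if_distrib[of "\<lambda>x. x *\<^sub>R _"]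
           if_distrib[of "\<lambda>x. x / _"] if_distrib[of "\<lambda>x. _ *\<^sub>R x"] cong: if_cong)
    also have "(\<Sum>j<N. \<Sum>t=1..T. \<Sum>i<n. if Suc i * t = j then a t i *\<^sub>R f j else 0)
        = (\<Sum>t=1..T. \<Sum>i<n. \<Sum>j<N. if Suc i * t = j then a t i *\<^sub>R f j else 0)"
      by (subst sum.swap) (intro sum.cong refl sum.swap)
    also have "\<dots> = (\<Sum>t=1..T. \<Sum>i<n. a t i *\<^sub>R f (Suc i * t))"
    proof (intro sum.cong refl)
      fix t i assume "t \<in> {1..T}" "i \<in> {..<n}"
      then show "(\<Sum>j<N. if Suc i * t = j then a t i *\<^sub>R f j else 0) = a t i *\<^sub>R f (Suc i * t)"
        using idx[of i t] by (subst sum.delta') auto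
    qed
    finally show ?thesis .
  qed
  have s1: "(\<Sum>j<N. \<phi> j) = 1" using sum_f[of "\<lambda>_. 1::real"] T1 by (simp add: a1)
  have s0: "(\<Sum>j<N. \<phi> j *\<^sub>R X j) = 0" using sum_f[of X] by (simp add: a0 del: mult_Suc)
  have T0: "real T > 0" using T1 by simp
  \<comment> \<open>For given \<open>i\<close> and \<open>j\<close> at most one \<open>t\<close>
    satisfies \<open>Suc i * t = j\<close>, so at most \<open>n\<close> coefficients meet at
    \<open>j\<close>. Dividing by \<open>T\<close> makes every weight of order
    \<open>1 / N\<close>.\<close>
  have sup: "\<bar>\<phi> j\<bar> \<le> real n * c / real T" for j
  proof -
    have "(\<Sum>t=1..T. if Suc i * t = j then \<bar>a t i\<bar> else 0) \<le> c" for i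
    proof -
      have "(\<Sum>t=1..T. if Suc i * t = j then \<bar>a t i\<bar> else 0) \<le> (\<Sum>t=1..T. if t = j div Suc i then c else 0)"
      proof (rule sum_mono)
        fix t
        show "(if Suc i * t = j then \<bar>a t i\<bar> else 0) \<le> (if t = j div Suc i then c else 0)"
        proof (cases "Suc i * t = j")
          case True
          then have t: "t = j div Suc i" using nonzero_mult_div_cancel_left[of "Suc i" t] by simp
          show ?thesis unfolding if_P[OF True] if_P[OF t] by (rule ac)
        next
          case False
          show ?thesis unfolding if_not_P[OF False] using c0 by simp
        qed
      qed
      also have "\<dots> \<le> c" using c0 by simp
      finally show ?thesis .
    qed
    then have "(\<Sum>i<n. \<Sum>t=1..T. if Suc i * t = j then \<bar>a t i\<bar> else 0) \<le> (\<Sum>i<n. c)" by (intro sum_mono)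
    moreover have "\<bar>\<Sum>t=1..T. \<Sum>i<n. if Suc i * t = j then a t i else 0\<bar>
        \<le> (\<Sum>t=1..T. \<Sum>i<n. if Suc i * t = j then \<bar>a t i\<bar> else 0)"
      by (rule order_trans[OF sum_abs sum_mono], rule order_trans[OF sum_abs sum_mono]) auto
    moreover have "(\<Sum>t=1..T. \<Sum>i<n. if Suc i * t = j then \<bar>a t i\<bar> else 0)
        = (\<Sum>i<n. \<Sum>t=1..T. if Suc i * t = j then \<bar>a t i\<bar> else 0)" by (rule sum.swap)
    ultimately have "\<bar>\<Sum>t=1..T. \<Sum>i<n. if Suc i * t = j then a t i else 0\<bar> \<le> real n * c" by simp
    then show ?thesis unfolding \<phi>_def using T0 by (simp add: divide_right_mono)
  qed
  have l1: "(\<Sum>j<N. \<bar>\<phi> j\<bar>) \<le> real n * c"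
  proof -
    \<comment> \<open>Testing \<open>sum_f\<close> with the signs of \<open>\<phi>\<close> expresses
      the sum of absolute values through the original coefficients.\<close>
    have "(\<Sum>j<N. \<bar>\<phi> j\<bar>) = (\<Sum>j<N. \<phi> j *\<^sub>R sgn (\<phi> j))" by (simp add: abs_sgn)
    also have "\<dots> = (1 / real T) * (\<Sum>t=1..T. \<Sum>i<n. a t i * sgn (\<phi> (Suc i * t)))"
      using sum_f[of "\<lambda>j. sgn (\<phi> j)"] by simp
    also have "\<dots> \<le> (1 / real T) * (\<Sum>t=1..T. \<Sum>i<n. c)"
    proof (intro mult_left_mono sum_mono)
      fix t i
      have "a t i * sgn (\<phi> (Suc i * t)) \<le> \<bar>a t i\<bar>" by (auto simp: sgn_if simp del: mult_Suc)
      then show "a t i * sgn (\<phi> (Suc i * t)) \<le> c" using ac[of t i] by linarith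
    qed simp
    finally show ?thesis using T0 by simp
  qed
  have "(\<Sum>j<N. (\<phi> j)\<^sup>2) \<le> (\<Sum>j<N. real n * c / real T * \<bar>\<phi> j\<bar>)"
  proof (rule sum_mono)
    fix j
    have "(\<phi> j)\<^sup>2 = \<bar>\<phi> j\<bar> * \<bar>\<phi> j\<bar>" by (simp add: power2_eq_square)
    then show "(\<phi> j)\<^sup>2 \<le> real n * c / real T * \<bar>\<phi> j\<bar>"
      using mult_right_mono[OF sup[of j], of "\<bar>\<phi> j\<bar>"] by simp
  qed
  also have "\<dots> \<le> real n * c / real T * (real n * c)"
    unfolding sum_distrib_left[symmetric] using l1 c0 by (intro mult_left_mono) auto
  finally have sq: "(\<Sum>j<N. (\<phi> j)\<^sup>2) \<le> (real n)\<^sup>2 * c\<^sup>2 / real T" by (simp add: power2_eq_square mult_ac)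
  have "real N \<le> 2 * real n * real T" using NT by (metis of_nat_le_iff of_nat_mult of_nat_numeral)
  then have "real N * (\<Sum>j<N. (\<phi> j)\<^sup>2) \<le> (2 * real n * real T) * ((real n)\<^sup>2 * c\<^sup>2 / real T)"
    using sq by (intro mult_mono) (auto intro: sum_nonneg)
  also have "\<dots> = 2 * real n ^ 3 * c\<^sup>2" using T0 by (simp add: power2_eq_square power3_eq_cube)
  finally show ?thesis using s1 s0 l1 by blast
qed

text \<open>The normal equation is solvable even if \<open>G\<close> is singular: the part
  \<open>z\<close> of \<open>v\<close> orthogonal to the range of \<open>G\<close> satisfies
  \<open>T z j = 0\<close> for all \<open>j < N\<close>, hence \<open>z \<bullet> v = 0\<close> and
  so \<open>z = 0\<close>. Degenerate constraints, as at abnormal minimisers, are thus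
  covered.\<close>

lemma least_squares_normal_equation:
  fixes T :: "'a::euclidean_space \<Rightarrow> nat \<Rightarrow> 'b::euclidean_space"
  assumes lin: "\<And>j. linear (\<lambda>a. T a j)"
  shows "\<exists>a. \<forall>b. (\<Sum>j<N. (u j - T a j) \<bullet> T b j) = 0"
proof -
  define adj where "adj j = adjoint (\<lambda>a. T a j)" for j
  have adj: "b \<bullet> adj j y = T b j \<bullet> y" for b j y
    unfolding adj_def using adjoint_works[OF lin] by simp
  have linadj: "linear (adj j)" for j unfolding adj_def by (rule adjoint_linear[OF lin])
  define G where "G a = (\<Sum>j<N. adj j (T a j))" for a
  define v where "v = (\<Sum>j<N. adj j (u j))"
  have "linear G" unfolding G_def
    by (intro linear_compose_sum ballI linear_compose[OF lin linadj, unfolded o_def])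
  then have sub: "subspace (range G)" by (simp add: linear_subspace_image)
  have G: "b \<bullet> G a = (\<Sum>j<N. T b j \<bullet> T a j)" for a b by (simp add: G_def inner_sum_right adj)
  have v: "b \<bullet> v = (\<Sum>j<N. T b j \<bullet> u j)" for b by (simp add: v_def inner_sum_right adj)
  obtain y z where y: "y \<in> span (range G)" and z: "\<And>w. w \<in> span (range G) \<Longrightarrow> orthogonal z w" and yz: "v = y + z"
    using orthogonal_subspace_decomp_exists[of "range G" v] by blast
  have "span (range G) = range G" using sub by (simp add: span_eq_iff)
  then have "y \<in> range G" using y by (simp only:)
  then obtain a where a: "y = G a" by blast
  have orth: "z \<bullet> G w = 0" for w using z[of "G w"] by (simp add: span_base orthogonal_def)
  have "(\<Sum>j<N. T z j \<bullet> T z j) = 0" using orth[of z] by (simp add: G)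
  then have "\<forall>j<N. T z j = 0" by (subst (asm) sum_nonneg_eq_0_iff) auto
  then have "z \<bullet> v = 0" by (simp add: v)
  then have "z \<bullet> z = 0" using orth[of a] yz a by (simp add: inner_add_right)
  then have "v = G a" using yz a by simp
  then have "(\<Sum>j<N. (u j - T a j) \<bullet> T b j) = 0" for b
  proof -
    have "(\<Sum>j<N. (u j - T a j) \<bullet> T b j) = b \<bullet> v - b \<bullet> G a"
      by (subst inner_commute) (simp add: v G inner_diff_right sum_subtractf)
    then show ?thesis by (simp add: \<open>v = G a\<close>)
  qed
  then show ?thesis by blast
qed

section \<open>Polygons and vertical shifts\<close>

lemma sum_lessThan_add:
  fixes f :: "nat \<Rightarrow> 'a::comm_monoid_add"
  shows "(\<Sum>i<a + b. f i) = (\<Sum>i<a. f i) + (\<Sum>i<b. f (a + i))"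
  by (induction b) (auto simp: add.assoc)

lemma exists_unit_relation:
  fixes v :: "nat \<Rightarrow> 'a::euclidean_space"
  shows "\<exists>\<alpha>::nat \<Rightarrow> real. (\<Sum>i<DIM('a) + 1. (\<alpha> i)\<^sup>2) = 1 \<and> (\<Sum>i<DIM('a) + 1. \<alpha> i *\<^sub>R v i) = 0"
proof -
  let ?K = "DIM('a) + 1"
  have "\<exists>\<beta>::nat \<Rightarrow> real. (\<exists>i<?K. \<beta> i \<noteq> 0) \<and> (\<Sum>i<?K. \<beta> i *\<^sub>R v i) = 0"
  \<comment> \<open>Linear dependence is a property of sets, so a repeated vector in the family is
    treated apart.\<close>
  proof (cases "inj_on v {..<?K}")
    case True
    then have "card (v ` {..<?K}) = ?K" by (simp add: card_image)
    then have "dependent (v ` {..<?K})" by (intro dependent_biggerset) auto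
    then obtain u where u: "\<exists>w\<in>v ` {..<?K}. u w \<noteq> 0" "(\<Sum>w\<in>v ` {..<?K}. u w *\<^sub>R w) = 0"
      by (auto simp: dependent_finite)
    then show ?thesis using True
      by (intro exI[of _ "u \<circ> v"]) (auto simp: sum.reindex simp del: sum.lessThan_Suc)
  next
    case False
    then obtain i j where ij: "i < ?K" "j < ?K" "i \<noteq> j" "v i = v j" by (auto simp: inj_on_def)
    have "(\<Sum>k<?K. (if k = i then 1 else if k = j then -1 else 0) *\<^sub>R v k)
        = (\<Sum>k<?K. (if k = i then v i else 0) - (if k = j then v j else 0))"
      using ij by (intro sum.cong) auto
    also have "\<dots> = v i - v j" using ij by (simp add: sum_subtractf del: sum.lessThan_Suc)
    finally show ?thesis using ij
      by (intro exI[of _ "\<lambda>k. if k = i then 1 else if k = j then -1 else 0"]) auto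
  qed
  then obtain \<beta> :: "nat \<Rightarrow> real" and i0
    where \<beta>: "i0 < ?K" "\<beta> i0 \<noteq> 0" "(\<Sum>i<?K. \<beta> i *\<^sub>R v i) = 0" by blast
  define s where "s = (\<Sum>i<?K. (\<beta> i)\<^sup>2)"
  have "s > 0" unfolding s_def using \<beta> by (intro sum_pos2[of _ i0]) auto
  have "(\<Sum>i<?K. (\<beta> i / sqrt s)\<^sup>2) = s / s"
    using \<open>s > 0\<close> by (simp add: power_divide s_def sum_divide_distrib[symmetric] del: sum.lessThan_Suc)
  moreover have "(\<Sum>i<?K. (\<beta> i / sqrt s) *\<^sub>R v i) = (1 / sqrt s) *\<^sub>R (\<Sum>i<?K. \<beta> i *\<^sub>R v i)"
    by (simp add: scaleR_sum_right del: sum.lessThan_Suc)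
  ultimately show ?thesis using \<open>s > 0\<close> \<beta>(3)
    by (intro exI[of _ "\<lambda>i. \<beta> i / sqrt s"]) (simp del: sum.lessThan_Suc)
qed

text \<open>A polygon is given by its increments \<open>\<xi> 0, \<xi> 1, \<dots>\<close> in the first layer, each run through in time
  \<open>1 / N\<close>; its endpoint is \<open>(psum \<xi> N, area B \<xi> \<xi> N)\<close>.\<close>

definition psum :: "(nat \<Rightarrow> 'a::real_vector) \<Rightarrow> nat \<Rightarrow> 'a" where
  "psum \<xi> n = (\<Sum>i<n. \<xi> i)"

definition area :: "('a::real_vector \<Rightarrow> 'a \<Rightarrow> 'b::real_vector) \<Rightarrow> (nat \<Rightarrow> 'a) \<Rightarrow> (nat \<Rightarrow> 'a) \<Rightarrow> nat \<Rightarrow> 'b" where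
  "area B \<xi> \<eta> N = (\<Sum>j<N. B (psum \<xi> j) (\<eta> j))"

text \<open>The integral of the squared speed: edge \<open>j\<close> is run at speed
  \<open>real N * norm (\<xi> j)\<close>.\<close>

definition energy :: "(nat \<Rightarrow> 'a::real_normed_vector) \<Rightarrow> nat \<Rightarrow> real" where
  "energy \<xi> N = real N * (\<Sum>j<N. (norm (\<xi> j))\<^sup>2)"

text \<open>Cuts every edge into \<open>k\<close> equal pieces. Endpoint and energy are preserved,
  so polygons can be brought to a common number of edges or be given as many as desired.\<close>

definition refine_poly :: "nat \<Rightarrow> (nat \<Rightarrow> 'a::real_vector) \<Rightarrow> nat \<Rightarrow> 'a" where
  "refine_poly k \<xi> j = \<xi> (j div k) /\<^sub>R real k"

lemma psum_0 [simp]: "psum \<xi> 0 = 0" and psum_Suc [simp]: "psum \<xi> (Suc n) = psum \<xi> n + \<xi> n"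
  by (simp_all add: psum_def)

lemma psum_add: "psum (\<lambda>j. \<xi> j + \<eta> j) n = psum \<xi> n + psum \<eta> n"
  by (simp add: psum_def sum.distrib)

lemma psum_scaleR: "psum (\<lambda>j. c *\<^sub>R \<xi> j) n = c *\<^sub>R psum \<xi> n"
  by (simp add: psum_def scaleR_sum_right)

lemma area_0 [simp]: "area B \<xi> \<eta> 0 = 0"
  and area_Suc [simp]: "area B \<xi> \<eta> (Suc N) = area B \<xi> \<eta> N + B (psum \<xi> N) (\<eta> N)"
  by (simp_all add: area_def)

lemma psum_sum: "psum (\<lambda>j. \<Sum>k\<in>A. f k j) n = (\<Sum>k\<in>A. psum (f k) n)"
  unfolding psum_def by (rule sum.swap)

lemma energy_add:
  fixes \<xi> \<eta> :: "nat \<Rightarrow> 'a::real_inner"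
  shows "energy (\<lambda>j. \<xi> j + \<eta> j) N = energy \<xi> N + energy \<eta> N + 2 * real N * (\<Sum>j<N. \<xi> j \<bullet> \<eta> j)"
proof -
  have "(\<Sum>j<N. (norm (\<xi> j + \<eta> j))\<^sup>2) = (\<Sum>j<N. (norm (\<xi> j))\<^sup>2 + (norm (\<eta> j))\<^sup>2 + 2 * (\<xi> j \<bullet> \<eta> j))"
    by (intro sum.cong) (simp_all add: power2_norm_eq_inner inner_add_left inner_add_right inner_commute)
  also have "\<dots> = (\<Sum>j<N. (norm (\<xi> j))\<^sup>2) + (\<Sum>j<N. (norm (\<eta> j))\<^sup>2) + 2 * (\<Sum>j<N. \<xi> j \<bullet> \<eta> j)"
    by (simp add: sum.distrib sum_distrib_left)
  finally show ?thesis by (simp add: energy_def algebra_simps)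
qed

lemma energy_scaleR: "energy (\<lambda>j. c *\<^sub>R \<xi> j) N = c\<^sup>2 * energy \<xi> N"
  by (simp add: energy_def power_mult_distrib sum_distrib_left algebra_simps)

lemma psum_refine:
  assumes "k > 0" "i \<le> k"
  shows "psum (refine_poly k \<xi>) (N * k + i) = psum \<xi> N + (real i / real k) *\<^sub>R \<xi> N"
  using assms(2)
proof (induction N arbitrary: i)
  case 0
  have "psum (refine_poly k \<xi>) i = (\<Sum>j<i. \<xi> 0 /\<^sub>R real k)"
    unfolding psum_def using 0 by (intro sum.cong) (auto simp: refine_poly_def)
  then show ?case by (simp add: sum_constant_scaleR divide_inverse)
next
  case (Suc N)
  have "psum (refine_poly k \<xi>) (Suc N * k + i)
      = psum (refine_poly k \<xi>) (N * k + k) + (\<Sum>j<i. refine_poly k \<xi> (Suc N * k + j))"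
    by (simp add: psum_def sum_lessThan_add add.commute[of k "N * k"])
  also have "(\<Sum>j<i. refine_poly k \<xi> (Suc N * k + j)) = (\<Sum>j<i. \<xi> (Suc N) /\<^sub>R real k)"
    using Suc.prems assms(1) by (intro sum.cong) (auto simp: refine_poly_def simp del: mult_Suc)
  also have "psum (refine_poly k \<xi>) (N * k + k) = psum \<xi> (Suc N)"
    using Suc.IH[of k] assms(1) by simp
  finally show ?case by (simp add: sum_constant_scaleR divide_inverse del: psum_Suc)
qed

lemma energy_refine:
  assumes "k > 0"
  shows "energy (refine_poly k \<xi>) (N * k) = energy \<xi> N"
proof -
  have "(\<Sum>j<N * k. (norm (refine_poly k \<xi> j))\<^sup>2) = (\<Sum>j<N. (norm (\<xi> j))\<^sup>2) / real k"
  proof (induction N)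
    case (Suc N)
    have "(\<Sum>j<k. (norm (refine_poly k \<xi> (N * k + j)))\<^sup>2) = (\<Sum>j<k. (norm (\<xi> N))\<^sup>2 / (real k)\<^sup>2)"
      by (intro sum.cong) (auto simp: refine_poly_def power_divide divide_inverse power_mult_distrib power_inverse)
    then show ?case using Suc assms
      by (simp add: add.commute[of k] sum_lessThan_add power2_eq_square add_divide_distrib)
  qed simp
  then show ?thesis using assms by (simp add: energy_def)
qed

section \<open>Bilinear calculus of areas, and the cost of vertical shifts\<close>

locale step2 =
  fixes B :: "real^'m \<Rightarrow> real^'m \<Rightarrow> real^'k"
  assumes carnot: "step2_carnot B"
begin

lemma bil: "bilinear B" and skew: "B x y = - B y x" and span_range: "span (range (\<lambda>(x, y). B x y)) = UNIV"
  using carnot unfolding step2_carnot_def by blast+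

lemmas B_simps = bilinear_ladd[OF bil] bilinear_radd[OF bil] bilinear_lmul[OF bil] bilinear_rmul[OF bil]
  bilinear_lneg[OF bil] bilinear_rneg[OF bil] bilinear_lzero[OF bil] bilinear_rzero[OF bil]
  bilinear_lsub[OF bil] bilinear_rsub[OF bil]

lemma B_self [simp]: "B x x = 0"
proof -
  have "B x x + B x x = 0" using eq_neg_iff_add_eq_0 skew by blast
  then show ?thesis by (simp flip: scaleR_2)
qed

lemma linear_B_left: "linear (\<lambda>x. B x y)" and linear_B_right: "linear (B x)"
  using bil by (auto simp: bilinear_def)

lemma B_sum_left: "B (sum f A) y = (\<Sum>i\<in>A. B (f i) y)"
  using linear_sum[OF linear_B_left[of y]] .

lemma B_sum_right: "B x (sum f A) = (\<Sum>i\<in>A. B x (f i))"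
  using linear_sum[OF linear_B_right[of x]] .

definition bracket_bound :: real where "bracket_bound = (SOME K. K > 0 \<and> (\<forall>x y. norm (B x y) \<le> K * norm x * norm y))"

lemma bracket_bound_pos: "bracket_bound > 0" and norm_B_le: "norm (B x y) \<le> bracket_bound * norm x * norm y"
proof -
  have "bracket_bound > 0 \<and> (\<forall>x y. norm (B x y) \<le> bracket_bound * norm x * norm y)"
    unfolding bracket_bound_def by (rule someI_ex) (use bilinear_bounded_pos[OF bil] in blast)
  then show "bracket_bound > 0" "norm (B x y) \<le> bracket_bound * norm x * norm y" by auto
qed

lemma area_add:
  "area B (\<lambda>j. \<xi> j + \<eta> j) (\<lambda>j. \<xi> j + \<eta> j) N
    = area B \<xi> \<xi> N + area B \<eta> \<eta> N + (area B \<xi> \<eta> N + area B \<eta> \<xi> N)"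
  by (simp add: area_def psum_add B_simps sum.distrib)

lemma area_scaleR: "area B (\<lambda>j. c *\<^sub>R \<xi> j) (\<lambda>j. d *\<^sub>R \<eta> j) N = (c * d) *\<^sub>R area B \<xi> \<eta> N"
  by (simp add: area_def psum_scaleR B_simps scaleR_sum_right mult.commute)

lemma area_refine:
  assumes "k > 0"
  shows "area B (refine_poly k \<xi>) (refine_poly k \<xi>) (N * k) = area B \<xi> \<xi> N"
proof (induction N)
  case (Suc N)
  have "(\<Sum>j<k. B (psum (refine_poly k \<xi>) (N * k + j)) (refine_poly k \<xi> (N * k + j)))
      = (\<Sum>j<k. B (psum \<xi> N) (\<xi> N) /\<^sub>R real k)"
    using assms by (intro sum.cong) (auto simp: psum_refine refine_poly_def B_simps)
  then show ?case using Suc assms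
    by (simp add: area_def add.commute[of k] sum_lessThan_add sum_constant_scaleR del: sum_constant)
qed simp

text \<open>A chain of closed parallelograms, the \<open>n\<close>-th one with sides scaled by
  \<open>\<alpha> n\<close>. Each returns to its horizontal starting point and contributes
  \<open>2 * (\<alpha> n)\<^sup>2\<close> times \<open>B x y\<close> to the area.\<close>

definition loops :: "(nat \<Rightarrow> real) \<Rightarrow> real^'m \<Rightarrow> real^'m \<Rightarrow> nat \<Rightarrow> real^'m" where
  "loops \<alpha> x y i = \<alpha> (i div 4) *\<^sub>R [x, y, - x, - y] ! (i mod 4)"

lemma loops_simps [simp]:
  "loops \<alpha> x y (4 * n) = \<alpha> n *\<^sub>R x" "loops \<alpha> x y (Suc (4 * n)) = \<alpha> n *\<^sub>R y"
  "loops \<alpha> x y (Suc (Suc (4 * n))) = - \<alpha> n *\<^sub>R x" "loops \<alpha> x y (Suc (Suc (Suc (4 * n)))) = - \<alpha> n *\<^sub>R y"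
proof -
  have "(Suc (4 * n)) mod 4 = 1" "(Suc (4 * n)) div 4 = n"
     "(Suc (Suc (4 * n))) mod 4 = 2" "(Suc (Suc (4 * n))) div 4 = n"
     "(Suc (Suc (Suc (4 * n)))) mod 4 = 3" "(Suc (Suc (Suc (4 * n)))) div 4 = n" by arith+
  then show "loops \<alpha> x y (4 * n) = \<alpha> n *\<^sub>R x" "loops \<alpha> x y (Suc (4 * n)) = \<alpha> n *\<^sub>R y"
  "loops \<alpha> x y (Suc (Suc (4 * n))) = - \<alpha> n *\<^sub>R x" "loops \<alpha> x y (Suc (Suc (Suc (4 * n)))) = - \<alpha> n *\<^sub>R y"
    by (simp_all add: loops_def)
qed

lemma four_Suc: "4 * Suc n = Suc (Suc (Suc (Suc (4 * n))))"
  by simp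

lemma psum_loops: "psum (loops \<alpha> x y) (4 * n) = 0"
  by (induction n) (simp_all only: four_Suc psum_Suc loops_simps, simp_all)

lemma area_loops: "area B (loops \<alpha> x y) (loops \<alpha> x y) (4 * n) = (\<Sum>i<n. (\<alpha> i)\<^sup>2) *\<^sub>R (2 *\<^sub>R B x y)"
proof (induction n)
  case (Suc n)
  show ?case
    by (simp only: four_Suc area_Suc psum_Suc loops_simps psum_loops Suc.IH sum.lessThan_Suc)
       (simp add: B_simps skew[of y x] scaleR_2 power2_eq_square scaleR_add_left scaleR_add_right)
qed simp

lemma energy_loops:
  "energy (loops \<alpha> x y) (4 * n) = real (8 * n) * (\<Sum>i<n. (\<alpha> i)\<^sup>2) * ((norm x)\<^sup>2 + (norm y)\<^sup>2)"
proof -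
  have "(\<Sum>j<4 * n. (norm (loops \<alpha> x y j))\<^sup>2) = 2 * (\<Sum>i<n. (\<alpha> i)\<^sup>2) * ((norm x)\<^sup>2 + (norm y)\<^sup>2)"
  proof (induction n)
    case (Suc n)
    show ?case
      by (simp only: four_Suc sum.lessThan_Suc loops_simps Suc.IH)
         (simp add: algebra_simps power_mult_distrib)
  qed simp
  then show ?thesis by (simp add: energy_def)
qed

text \<open>The cost \<open>C\<close> is uniform over all polygons. Requiring
  \<open>N' \<ge> N\<close> keeps the number of edges positive, so that shifts can be performed one
  after the other.\<close>

definition shiftable :: "real \<Rightarrow> real^'k \<Rightarrow> bool" where
  "shiftable C e \<longleftrightarrow> (\<forall>N\<ge>1. \<forall>\<xi>. \<exists>N'\<ge>N. \<exists>\<xi>'. psum \<xi>' N' = psum \<xi> N \<and>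
      area B \<xi>' \<xi>' N' = area B \<xi> \<xi> N + e \<and> energy \<xi>' N' \<le> energy \<xi> N + C)"

text \<open>The weights of the loops are chosen such that the loops interact with the polygon neither in the
  area nor in the energy.\<close>
lemma shiftable_bracket: "shiftable (8 * (DIM((real^'k) \<times> real) + 1) * ((norm x)\<^sup>2 + (norm y)\<^sup>2)) (2 *\<^sub>R B x y)"
  unfolding shiftable_def
proof (intro allI impI)
  fix N :: nat and \<xi> :: "nat \<Rightarrow> real^'m"
  assume N: "1 \<le> N"
  \<comment> \<open>One loop more than the dimension of the space in which the interactions
    \<open>F\<close> live, so that the interactions of the single loops are linearly
    dependent.\<close>
  define K where "K = DIM((real^'k) \<times> real) + 1"
  define \<zeta> where "\<zeta> = refine_poly (4 * K) \<xi>"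
  define N' where "N' = N * (4 * K)"
  have N': "N' = (4 * K) * N" by (simp add: N'_def)
  define r where "r \<alpha> = refine_poly N (loops \<alpha> x y)" for \<alpha>
  define u where "u \<kappa> = r (\<lambda>i. if i = \<kappa> then 1 else 0)" for \<kappa>
  \<comment> \<open>The cross terms of area and energy. If they vanish, adding the loops to
    \<open>\<zeta>\<close> simply adds areas and energies.\<close>
  define F where "F \<eta> = (area B \<zeta> \<eta> N' + area B \<eta> \<zeta> N', \<Sum>j<N'. \<zeta> j \<bullet> \<eta> j)" for \<eta>
  obtain \<alpha> where \<alpha>1: "(\<Sum>i<K. (\<alpha> i)\<^sup>2) = 1" and \<alpha>0: "(\<Sum>i<K. \<alpha> i *\<^sub>R F (u i)) = 0"
    using exists_unit_relation[of "\<lambda>i. F (u i)"] unfolding K_def by blast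
  have rsum: "r \<alpha> j = (\<Sum>\<kappa><K. \<alpha> \<kappa> *\<^sub>R u \<kappa> j)" if "j < N'" for j
  proof -
    have "j div N < 4 * K" using that by (simp add: N' less_mult_imp_div_less)
    then have lt: "j div N div 4 < K" by linarith
    have "(\<Sum>\<kappa><K. \<alpha> \<kappa> *\<^sub>R u \<kappa> j) = (\<Sum>\<kappa><K. if \<kappa> = j div N div 4 then r \<alpha> j else 0)"
      by (intro sum.cong) (auto simp: u_def r_def refine_poly_def loops_def)
    also have "\<dots> = r \<alpha> j" using lt by simp
    finally show ?thesis by simp
  qed
  have psr: "psum (r \<alpha>) j = (\<Sum>\<kappa><K. \<alpha> \<kappa> *\<^sub>R psum (u \<kappa>) j)" if "j \<le> N'" for j
  proof -
    have "psum (r \<alpha>) j = psum (\<lambda>j. \<Sum>\<kappa><K. \<alpha> \<kappa> *\<^sub>R u \<kappa> j) j"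
      unfolding psum_def using that by (intro sum.cong) (auto simp: rsum)
    then show ?thesis by (simp add: psum_sum psum_scaleR)
  qed
  have a1: "area B \<zeta> (r \<alpha>) N' = (\<Sum>\<kappa><K. \<alpha> \<kappa> *\<^sub>R area B \<zeta> (u \<kappa>) N')"
    unfolding area_def scaleR_sum_right by (subst sum.swap) (auto intro!: sum.cong simp: rsum B_sum_right B_simps)
  have a2: "area B (r \<alpha>) \<zeta> N' = (\<Sum>\<kappa><K. \<alpha> \<kappa> *\<^sub>R area B (u \<kappa>) \<zeta> N')"
    unfolding area_def scaleR_sum_right by (subst sum.swap) (auto intro!: sum.cong simp: psr B_sum_left B_simps)
  have a3: "(\<Sum>j<N'. \<zeta> j \<bullet> r \<alpha> j) = (\<Sum>\<kappa><K. \<alpha> \<kappa> * (\<Sum>j<N'. \<zeta> j \<bullet> u \<kappa> j))"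
    unfolding sum_distrib_left by (subst sum.swap) (auto intro!: sum.cong simp: rsum inner_sum_right)
  have "F (r \<alpha>) = (\<Sum>i<K. \<alpha> i *\<^sub>R F (u i))"
    unfolding F_def a1 a2 a3 by (simp add: prod_eq_iff fst_sum snd_sum sum.distrib scaleR_add_right)
  then have "F (r \<alpha>) = 0" by (simp only: \<alpha>0)
  then have F0: "area B \<zeta> (r \<alpha>) N' + area B (r \<alpha>) \<zeta> N' = 0" "(\<Sum>j<N'. \<zeta> j \<bullet> r \<alpha> j) = 0"
    by (simp_all add: F_def zero_prod_def)
  have K0: "0 < 4 * K" by (simp add: K_def)
  have psz: "psum \<zeta> N' = psum \<xi> N"
    using psum_refine[OF K0, of 0 \<xi> N] by (simp add: \<zeta>_def N'_def)
  have arz: "area B \<zeta> \<zeta> N' = area B \<xi> \<xi> N" and enz: "energy \<zeta> N' = energy \<xi> N"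
    unfolding \<zeta>_def N'_def by (intro area_refine energy_refine K0)+
  have N0: "0 < N" using N by simp
  have "psum (r \<alpha>) N' = 0"
    using psum_refine[OF N0, of 0 "loops \<alpha> x y" "4 * K"] by (simp add: r_def N' psum_loops)
  moreover have "area B (r \<alpha>) (r \<alpha>) N' = 2 *\<^sub>R B x y"
    unfolding r_def N' area_refine[OF N0] area_loops \<alpha>1 by simp
  moreover have "energy (r \<alpha>) N' = real (8 * K) * ((norm x)\<^sup>2 + (norm y)\<^sup>2)"
    unfolding r_def N' energy_refine[OF N0] energy_loops \<alpha>1 by simp
  ultimately show "\<exists>N'\<ge>N. \<exists>\<xi>'. psum \<xi>' N' = psum \<xi> N \<and>
      area B \<xi>' \<xi>' N' = area B \<xi> \<xi> N + 2 *\<^sub>R B x y \<and>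
      energy \<xi>' N' \<le> energy \<xi> N + (8 * (DIM((real^'k) \<times> real) + 1) * ((norm x)\<^sup>2 + (norm y)\<^sup>2))"
    using F0 psz arz enz K0
    by (intro exI[of _ N'] exI[of _ "\<lambda>j. \<zeta> j + r \<alpha> j"] conjI)
       (simp_all add: N'_def[symmetric] psum_add area_add energy_add K_def[symmetric],
        simp_all add: N'_def K_def)
qed

lemma shiftable_add:
  assumes "shiftable C e" "shiftable C' e'"
  shows "shiftable (C + C') (e + e')"
  unfolding shiftable_def
proof (intro allI impI)
  fix N :: nat and \<xi> :: "nat \<Rightarrow> real^'m"
  assume N: "1 \<le> N"
  obtain N1 \<xi>1 where 1: "N1 \<ge> N" "psum \<xi>1 N1 = psum \<xi> N" "area B \<xi>1 \<xi>1 N1 = area B \<xi> \<xi> N + e"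
     "energy \<xi>1 N1 \<le> energy \<xi> N + C"
    using assms(1) N unfolding shiftable_def by blast
  then have "1 \<le> N1" using N by simp
  then obtain N2 \<xi>2 where 2: "N2 \<ge> N1" "psum \<xi>2 N2 = psum \<xi>1 N1" "area B \<xi>2 \<xi>2 N2 = area B \<xi>1 \<xi>1 N1 + e'"
     "energy \<xi>2 N2 \<le> energy \<xi>1 N1 + C'"
    using assms(2) unfolding shiftable_def by blast
  show "\<exists>N'\<ge>N. \<exists>\<xi>'. psum \<xi>' N' = psum \<xi> N \<and>
      area B \<xi>' \<xi>' N' = area B \<xi> \<xi> N + (e + e') \<and> energy \<xi>' N' \<le> energy \<xi> N + (C + C')"
    using 1 2 by (intro exI[of _ N2] exI[of _ \<xi>2] conjI) auto
qed

lemma shiftable_0: "shiftable 0 0"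
  unfolding shiftable_def by auto

text \<open>The directions with a linear cost form a subspace. It contains every bracket, and the
  brackets span the second layer.\<close>

lemma shiftable_line: "\<exists>C\<ge>0. \<forall>t. shiftable (C * \<bar>t\<bar>) (t *\<^sub>R e)"
proof -
  let ?S = "{e. \<exists>C\<ge>0. \<forall>t. shiftable (C * \<bar>t\<bar>) (t *\<^sub>R e)}"
  have "subspace ?S"
  proof (rule subspaceI)
    show "0 \<in> ?S" using shiftable_0 by (auto intro: exI[of _ 0])
  next
    fix e e' assume "e \<in> ?S" "e' \<in> ?S"
    then obtain C C' where "C \<ge> 0" "\<And>t. shiftable (C * \<bar>t\<bar>) (t *\<^sub>R e)" "C' \<ge> 0" "\<And>t. shiftable (C' * \<bar>t\<bar>) (t *\<^sub>R e')"
      by blast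
    then have "C + C' \<ge> 0 \<and> (\<forall>t. shiftable ((C + C') * \<bar>t\<bar>) (t *\<^sub>R (e + e')))"
      by (auto simp: distrib_right scaleR_add_right intro: shiftable_add)
    then show "e + e' \<in> ?S" by blast
  next
    fix c e assume "e \<in> ?S"
    then obtain C where C: "C \<ge> 0" "\<And>t. shiftable (C * \<bar>t\<bar>) (t *\<^sub>R e)" by blast
    have "\<forall>t. shiftable ((C * \<bar>c\<bar>) * \<bar>t\<bar>) (t *\<^sub>R (c *\<^sub>R e))"
    proof
      fix t show "shiftable ((C * \<bar>c\<bar>) * \<bar>t\<bar>) (t *\<^sub>R (c *\<^sub>R e))"
        using C(2)[of "t * c"] by (simp add: abs_mult mult_ac)
    qed
    then show "c *\<^sub>R e \<in> ?S" using C(1) by (auto intro: exI[of _ "C * \<bar>c\<bar>"])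
  qed
  moreover have "range (\<lambda>(x, y). B x y) \<subseteq> ?S"
  proof clarify
    fix x y :: "real^'m"
    define D where "D = 8 * real (DIM((real^'k) \<times> real) + 1)"
    have "\<forall>t. shiftable ((D * ((norm x)\<^sup>2 + (norm y)\<^sup>2) / 2) * \<bar>t\<bar>) (t *\<^sub>R B x y)"
    proof
      fix t :: real
      \<comment> \<open>Sides scaled by the square root make both the enclosed area and the energy
        linear in \<open>\<bar>t\<bar>\<close>; the sign of \<open>t\<close> is put on one side
        only.\<close>
      define s where "s = sqrt (\<bar>t\<bar> / 2)"
      have s2: "s * s = \<bar>t\<bar> / 2" by (simp add: s_def)
      have "shiftable (D * ((norm ((sgn t * s) *\<^sub>R x))\<^sup>2 + (norm (s *\<^sub>R y))\<^sup>2)) (2 *\<^sub>R B ((sgn t * s) *\<^sub>R x) (s *\<^sub>R y))"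
        using shiftable_bracket[of "(sgn t * s) *\<^sub>R x" "s *\<^sub>R y"] unfolding D_def by simp
      moreover have "2 *\<^sub>R B ((sgn t * s) *\<^sub>R x) (s *\<^sub>R y) = t *\<^sub>R B x y"
      proof -
        have "s * (sgn t * s) = sgn t * (s * s)" by (simp add: mult_ac)
        then have "2 * (s * (sgn t * s)) = t" by (simp add: s2 sgn_mult_abs)
        then show ?thesis by (simp add: B_simps)
      qed
      moreover have "D * ((norm ((sgn t * s) *\<^sub>R x))\<^sup>2 + (norm (s *\<^sub>R y))\<^sup>2) = (D * ((norm x)\<^sup>2 + (norm y)\<^sup>2) / 2) * \<bar>t\<bar>"
      proof -
        have "s\<^sup>2 = \<bar>t\<bar> / 2" by (simp add: s2 power2_eq_square)
        moreover have "(sgn t)\<^sup>2 * \<bar>t\<bar> = \<bar>t\<bar>" by (simp add: sgn_real_def)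
        ultimately have nn: "(norm ((sgn t * s) *\<^sub>R x))\<^sup>2 = \<bar>t\<bar> / 2 * (norm x)\<^sup>2"
          "(norm (s *\<^sub>R y))\<^sup>2 = \<bar>t\<bar> / 2 * (norm y)\<^sup>2"
          by (simp_all add: power_mult_distrib abs_mult)
        show ?thesis unfolding nn by (simp add: algebra_simps)
      qed
      ultimately show "shiftable ((D * ((norm x)\<^sup>2 + (norm y)\<^sup>2) / 2) * \<bar>t\<bar>) (t *\<^sub>R B x y)" by (simp only:)
    qed
    then show "\<exists>C\<ge>0. \<forall>t. shiftable (C * \<bar>t\<bar>) (t *\<^sub>R B x y)"
      by (intro exI[of _ "D * ((norm x)\<^sup>2 + (norm y)\<^sup>2) / 2"]) (auto simp: D_def)
  qed
  ultimately have "span (range (\<lambda>(x, y). B x y)) \<subseteq> ?S" by (intro span_minimal)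
  then show ?thesis using span_range by auto
qed

lemma shiftable_ex: "\<exists>C>0. \<forall>e. shiftable (C * norm e) e"
proof -
  have "\<forall>b. \<exists>C\<ge>0. \<forall>t. shiftable (C * \<bar>t\<bar>) (t *\<^sub>R b)" using shiftable_line by blast
  then obtain c where c: "\<And>b. c b \<ge> 0" "\<And>b t. shiftable (c b * \<bar>t\<bar>) (t *\<^sub>R b)" by metis
  \<comment> \<open>Shift along the coordinate directions in turn. The extra \<open>norm e\<close>
    makes the final constant strictly positive.\<close>
  have "shiftable ((\<Sum>b\<in>Basis. c b) * norm e + norm e) e" for e
  proof -
    have "shiftable (\<Sum>b\<in>A. c b * \<bar>e \<bullet> b\<bar>) (\<Sum>b\<in>A. (e \<bullet> b) *\<^sub>R b)" if "finite A" for A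
      using that by (induction A rule: finite_induct) (auto intro: shiftable_0 shiftable_add c)
    from this[of Basis] have sh: "shiftable (\<Sum>b\<in>Basis. c b * \<bar>e \<bullet> b\<bar>) e"
      by (simp add: euclidean_representation)
    have "(\<Sum>b\<in>Basis. c b * \<bar>e \<bullet> b\<bar>) \<le> (\<Sum>b\<in>Basis. c b) * norm e"
      unfolding sum_distrib_right by (intro sum_mono mult_left_mono c Basis_le_norm)
    then show ?thesis using sh norm_ge_zero[of e] unfolding shiftable_def by (smt (verit, best))
  qed
  moreover have "(\<Sum>b\<in>Basis. c b) + 1 > 0" by (simp add: sum_nonneg c add_nonneg_pos)
  ultimately show ?thesis by (intro exI[of _ "(\<Sum>b\<in>Basis. c b) + 1"]) (auto simp: algebra_simps)
qed

definition shift_cost :: real where "shift_cost = (SOME C. C > 0 \<and> (\<forall>e. shiftable (C * norm e) e))"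

lemma shift_cost_pos: "shift_cost > 0" and shiftable_shift_cost: "shiftable (shift_cost * norm e) e"
proof -
  have "shift_cost > 0 \<and> (\<forall>e. shiftable (shift_cost * norm e) e)"
    unfolding shift_cost_def by (rule someI_ex) (rule shiftable_ex)
  then show "shift_cost > 0" "shiftable (shift_cost * norm e) e" by auto
qed

end

section \<open>Carnot-Caratheodory distance and energy of polygons\<close>

lemma psum_cong: "(\<And>i. i < n \<Longrightarrow> \<xi> i = \<eta> i) \<Longrightarrow> psum \<xi> n = psum \<eta> n"
  by (simp add: psum_def)

lemma area_cong: "(\<And>i. i < n \<Longrightarrow> \<xi> i = \<eta> i) \<Longrightarrow> area B \<xi> \<xi> n = area B \<eta> \<eta> n"
  unfolding area_def by (intro sum.cong refl arg_cong2[where f = B] psum_cong) auto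

section \<open>Piecewise affine paths and their derivatives\<close>

definition unit_clamp :: "real \<Rightarrow> real" where "unit_clamp c = max 0 (min 1 c)"

lemma unit_clamp_deriv:
  assumes "N > 0" "N * t \<noteq> a" "N * t \<noteq> a + 1"
  shows "((\<lambda>t. unit_clamp (N * t - a)) has_real_derivative (if a < N * t \<and> N * t < a + 1 then N else 0)) (at t)"
proof -
  consider "N * t < a" | "a < N * t" "N * t < a + 1" | "a + 1 < N * t" using assms by linarith
  then show ?thesis
  proof cases
    case 1
    have "eventually (\<lambda>s. s \<in> {..<a / N}) (nhds t)"
      using assms 1 by (intro eventually_nhds_in_open) (auto simp: field_simps)
    then have "eventually (\<lambda>s. unit_clamp (N * s - a) = 0) (nhds t)"
      by eventually_elim (use assms in \<open>auto simp: unit_clamp_def field_simps\<close>)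
    then have "((\<lambda>t. unit_clamp (N * t - a)) has_real_derivative 0) (at t)"
      by (subst DERIV_cong_ev[OF refl _ refl]) auto
    then show ?thesis using 1 by simp
  next
    case 2
    have "eventually (\<lambda>s. s \<in> {a / N<..<(a + 1) / N}) (nhds t)"
      using assms 2 by (intro eventually_nhds_in_open) (auto simp: field_simps)
    then have "eventually (\<lambda>s. unit_clamp (N * s - a) = N * s - a) (nhds t)"
      by eventually_elim (use assms in \<open>auto simp: unit_clamp_def field_simps\<close>)
    moreover have "((\<lambda>s. N * s - a) has_real_derivative N) (at t)"
      by (auto intro!: derivative_eq_intros)
    ultimately have "((\<lambda>t. unit_clamp (N * t - a)) has_real_derivative N) (at t)"
      by (subst DERIV_cong_ev[OF refl _ refl]) auto
    then show ?thesis using 2 by simp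
  next
    case 3
    have "eventually (\<lambda>s. s \<in> {(a + 1) / N<..}) (nhds t)"
      using assms 3 by (intro eventually_nhds_in_open) (auto simp: field_simps)
    then have "eventually (\<lambda>s. unit_clamp (N * s - a) = 1) (nhds t)"
      by eventually_elim (use assms in \<open>auto simp: unit_clamp_def field_simps\<close>)
    then have "((\<lambda>t. unit_clamp (N * t - a)) has_real_derivative 0) (at t)"
      by (subst DERIV_cong_ev[OF refl _ refl]) auto
    then show ?thesis using 3 by simp
  qed
qed

text \<open>The path that is affine between the partial sums of \<open>f\<close>, attained at the
  times \<open>j / N\<close>. As a sum of ramps it is visibly continuous, and in each open cell only
  one ramp is moving.\<close>

definition clamp_path :: "nat \<Rightarrow> (nat \<Rightarrow> 'a::real_normed_vector) \<Rightarrow> real \<Rightarrow> 'a" where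
  "clamp_path N f t = (\<Sum>j<N. unit_clamp (real N * t - real j) *\<^sub>R f j)"

definition clamp_grid :: "nat \<Rightarrow> real set" where
  "clamp_grid N = (\<lambda>j. real j / real N) ` {..N}"

lemma clamp_path_continuous: "continuous_on A (clamp_path N f)"
  unfolding clamp_path_def unit_clamp_def by (intro continuous_intros)

lemma clamp_path_0: "clamp_path N f 0 = 0"
  by (simp add: clamp_path_def unit_clamp_def)

lemma clamp_path_1: "clamp_path N f 1 = (\<Sum>j<N. f j)"
  unfolding clamp_path_def by (intro sum.cong) (auto simp: unit_clamp_def)

lemma cell_unique:
  assumes "real i < a" "a < real i + 1"
  shows "(real j < a \<and> a < real j + 1) \<longleftrightarrow> j = i"
proof
  assume "real j < a \<and> a < real j + 1"
  then have "real j < real (Suc i)" "real i < real (Suc j)" using assms by auto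
  then show "j = i" unfolding of_nat_less_iff by simp
qed (use assms in auto)

lemma clamp_cell:
  assumes N: "N > 0" and t: "0 < t" "t < 1" "t \<notin> clamp_grid N"
  obtains i where "i < N" "real i < real N * t" "real N * t < real i + 1"
proof
  let ?i = "nat \<lfloor>real N * t\<rfloor>"
  have ri: "real ?i = of_int \<lfloor>real N * t\<rfloor>" using N t by (simp add: of_nat_nat)
  have le: "real ?i \<le> real N * t" "real N * t < real ?i + 1" unfolding ri by linarith+
  have "real N * t < real N" using N t by simp
  with le show "?i < N" by linarith
  then have "real ?i / real N \<in> clamp_grid N" by (simp add: clamp_grid_def)
  then have "t \<noteq> real ?i / real N" using t(3) by metis
  then have "real ?i \<noteq> real N * t" using N by (simp add: field_simps)
  with le show "real ?i < real N * t" "real N * t < real ?i + 1" by linarith+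
qed

lemma clamp_path_cell:
  assumes i: "i < N" "real i < real N * t" "real N * t < real i + 1"
  shows "clamp_path N f t = (\<Sum>j<i. f j) + (real N * t - real i) *\<^sub>R f i"
proof -
  let ?g = "\<lambda>j. unit_clamp (real N * t - real j) *\<^sub>R f j"
  have "clamp_path N f t = (\<Sum>j<i. ?g j) + ?g i + (\<Sum>k<N - Suc i. ?g (Suc i + k))"
    using sum_lessThan_add[of ?g "Suc i" "N - Suc i"] i by (simp add: clamp_path_def)
  also have "(\<Sum>k<N - Suc i. ?g (Suc i + k)) = 0"
    using i by (intro sum.neutral) (auto simp: unit_clamp_def max_def min_def)
  also have "(\<Sum>j<i. ?g j) = (\<Sum>j<i. f j)"
    using i by (intro sum.cong) (auto simp: unit_clamp_def max_def min_def)
  also have "unit_clamp (real N * t - real i) = real N * t - real i"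
    using i by (auto simp: unit_clamp_def)
  finally show ?thesis by simp
qed

lemma clamp_path_deriv:
  assumes i: "i < N" "real i < real N * t" "real N * t < real i + 1"
  shows "(clamp_path N f has_vector_derivative (real N *\<^sub>R f i)) (at t)"
proof -
  have ne: "real N * t \<noteq> real j" "real N * t \<noteq> real j + 1" for j
  proof -
    have "real N * t \<noteq> real j" for j
    proof
      assume "real N * t = real j"
      with i have "real i < real j" "real j < real (Suc i)" by simp_all
      then show False unfolding of_nat_less_iff by simp
    qed
    from this[of j] this[of "Suc j"] show "real N * t \<noteq> real j" "real N * t \<noteq> real j + 1" by (simp_all add: add.commute)
  qed
  have N: "real N > 0" using i by simp
  have "(clamp_path N f has_vector_derivative
      (\<Sum>j<N. (if real j < real N * t \<and> real N * t < real j + 1 then real N else 0) *\<^sub>R f j)) (at t)"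
    unfolding clamp_path_def
    by (intro has_vector_derivative_sum)
       (use unit_clamp_deriv[OF N ne] in \<open>auto intro!: derivative_eq_intros\<close>)
  moreover have "(\<Sum>j<N. (if real j < real N * t \<and> real N * t < real j + 1 then real N else 0) *\<^sub>R f j)
     = (\<Sum>j<N. if j = i then real N *\<^sub>R f i else 0)"
  proof (intro sum.cong refl)
    fix j
    have "(real j < real N * t \<and> real N * t < real j + 1) \<longleftrightarrow> j = i"
      using i by (intro cell_unique)
    then show "(if real j < real N * t \<and> real N * t < real j + 1 then real N else 0) *\<^sub>R f j
      = (if j = i then real N *\<^sub>R f i else 0)" by simp
  qed
  ultimately show ?thesis using i by simp
qed

text \<open>The fundamental theorem of calculus tolerates finitely many exceptional points, so
  \<open>f'\<close> may take any values on the grid.\<close>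

lemma has_integral_clamp_path:
  assumes N: "N > 0" and t: "0 \<le> t" "t \<le> 1"
    and f': "\<And>i s. i < N \<Longrightarrow> real i < real N * s \<Longrightarrow> real N * s < real i + 1 \<Longrightarrow> f' s = real N *\<^sub>R f i"
  shows "(f' has_integral clamp_path N (f :: nat \<Rightarrow> 'a::banach) t) {0..t}"
proof -
  have "(f' has_integral (clamp_path N f t - clamp_path N f 0)) {0..t}"
  proof (rule fundamental_theorem_of_calculus_interior_strong)
    show "finite (clamp_grid N)" by (simp add: clamp_grid_def)
    fix s assume s: "s \<in> {0<..<t} - clamp_grid N"
    then obtain i where i: "i < N" "real i < real N * s" "real N * s < real i + 1"
      using clamp_cell[OF N, of s] t by auto
    show "(clamp_path N f has_vector_derivative f' s) (at s)"
      using clamp_path_deriv[OF i] f'[OF i] by simp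
  qed (use t clamp_path_continuous in auto)
  then show ?thesis by (simp add: clamp_path_0)
qed

section \<open>Passing between horizontal curves and polygons\<close>

context step2 begin

lemma gmult_assoc: "gmult B (gmult B p q) r = gmult B p (gmult B q r)"
  by (simp add: gmult_def B_simps)

lemma gmult_inverse: "gmult B (- p) (gmult B p q) = q" "gmult B p (gmult B (- p) q) = q"
  by (simp_all add: gmult_def B_simps prod_eq_iff)

text \<open>Along an edge the position changes by multiples of \<open>\<xi> j\<close>, which
  \<open>B\<close> does not see against \<open>\<xi> j\<close>. The vertical velocity is therefore
  constant on each edge, and the lifted curve is again piecewise affine, with increments
  \<open>dG\<close>.\<close>

lemma polygon_horizontal:
  assumes N: "N \<ge> 1" and w: "psum \<xi> N = fst w" "area B \<xi> \<xi> N = snd w"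
  shows "\<exists>\<gamma> u. horizontal B \<gamma> u \<and> \<gamma> 0 = p \<and> \<gamma> 1 = gmult B p w \<and>
    integral {0..1} (\<lambda>s. norm (u s)) = (\<Sum>j<N. norm (\<xi> j))"
proof -
  have N0: "N > 0" using N by simp
  define dG where "dG j = (\<xi> j, B (fst p + psum \<xi> j) (\<xi> j))" for j
  define \<gamma> where "\<gamma> t = p + clamp_path N dG t" for t
  define u where "u t = real N *\<^sub>R (\<Sum>j<N. if real j < real N * t \<and> real N * t < real j + 1 then \<xi> j else 0)" for t
  have u: "u s = real N *\<^sub>R \<xi> i" if i: "i < N" "real i < real N * s" "real N * s < real i + 1" for i s
  proof -
    have "(\<Sum>j<N. if real j < real N * s \<and> real N * s < real j + 1 then \<xi> j else 0) = (\<Sum>j<N. if j = i then \<xi> i else 0)"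
    proof (intro sum.cong refl)
      fix j
      have "(real j < real N * s \<and> real N * s < real j + 1) \<longleftrightarrow> j = i"
        using i by (intro cell_unique)
      then show "(if real j < real N * s \<and> real N * s < real j + 1 then \<xi> j else 0) = (if j = i then \<xi> i else 0)" by simp
    qed
    then show ?thesis using i by (simp add: u_def)
  qed
  have sumdG: "(\<Sum>j<n. dG j) = (psum \<xi> n, area B \<xi> \<xi> n + B (fst p) (psum \<xi> n))" for n
    by (induction n) (simp_all add: dG_def zero_prod_def B_simps)
  have hor: "((\<lambda>s. (u s, B (fst (\<gamma> s)) (u s))) has_integral (\<gamma> t - \<gamma> 0)) {0..t}" if "t \<in> {0..1}" for t
  proof -
    have "((\<lambda>s. (u s, B (fst (\<gamma> s)) (u s))) has_integral clamp_path N dG t) {0..t}"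
    proof (rule has_integral_clamp_path[OF N0])
      fix i s assume i: "i < N" "real i < real N * s" "real N * s < real i + 1"
      have "fst (\<gamma> s) = fst p + psum \<xi> i + (real N * s - real i) *\<^sub>R \<xi> i"
        unfolding \<gamma>_def clamp_path_cell[OF i] sumdG by (simp add: dG_def)
      then show "(u s, B (fst (\<gamma> s)) (u s)) = real N *\<^sub>R dG i"
        by (simp add: u[OF i] dG_def B_simps)
    qed (use that in auto)
    then show ?thesis by (simp add: \<gamma>_def clamp_path_0)
  qed
  have iu: "(u has_integral clamp_path N \<xi> 1) {0..1}"
    by (rule has_integral_clamp_path[OF N0]) (auto simp: u)
  have inu: "((\<lambda>s. norm (u s)) has_integral clamp_path N (\<lambda>j. norm (\<xi> j)) 1) {0..1}"
    by (rule has_integral_clamp_path[OF N0]) (auto simp: u)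
  have "u absolutely_integrable_on {0..1}"
    using iu inu by (intro absolutely_integrable_onI) auto
  then have "horizontal B \<gamma> u" using hor by (simp add: horizontal_def)
  moreover have "\<gamma> 0 = p" by (simp add: \<gamma>_def clamp_path_0)
  moreover have "\<gamma> 1 = gmult B p w"
    by (simp add: \<gamma>_def clamp_path_1 sumdG w gmult_def prod_eq_iff)
  moreover have "integral {0..1} (\<lambda>s. norm (u s)) = (\<Sum>j<N. norm (\<xi> j))"
    using inu by (simp add: clamp_path_1 integral_unique)
  ultimately show ?thesis by blast
qed

lemma horizontal_integral:
  assumes "horizontal B \<gamma> u" "0 \<le> a" "a \<le> b" "b \<le> 1"
  shows "((\<lambda>s. (u s, B (fst (\<gamma> s)) (u s))) has_integral (\<gamma> b - \<gamma> a)) {a..b}"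
proof -
  let ?F = "\<lambda>s. (u s, B (fst (\<gamma> s)) (u s))"
  have h: "(?F has_integral (\<gamma> t - \<gamma> 0)) {0..t}" if "t \<in> {0..1}" for t
    using assms(1) that by (auto simp: horizontal_def)
  have a: "(?F has_integral (\<gamma> a - \<gamma> 0)) {0..a}" and b: "(?F has_integral (\<gamma> b - \<gamma> 0)) {0..b}"
    using assms by (auto intro!: h)
  have "?F integrable_on {a..b}"
    by (rule integrable_on_subinterval[of _ "{0..b}"]) (use b assms in auto)
  then have ab: "(?F has_integral integral {a..b} ?F) {a..b}" by blast
  have "(?F has_integral (\<gamma> a - \<gamma> 0 + integral {a..b} ?F)) {0..b}"
    using assms by (intro has_integral_combine[OF _ _ a ab]) auto
  then have "\<gamma> a - \<gamma> 0 + integral {a..b} ?F = \<gamma> b - \<gamma> 0" using b has_integral_unique by blast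
  then have "integral {a..b} ?F = \<gamma> b - \<gamma> a" by (simp add: algebra_simps)
  then show ?thesis using ab by simp
qed

lemma horizontal_continuous:
  assumes "horizontal B \<gamma> u"
  shows "continuous_on {0..1} \<gamma>"
proof -
  let ?F = "\<lambda>s. (u s, B (fst (\<gamma> s)) (u s))"
  have "?F integrable_on {0..1}" using horizontal_integral[OF assms, of 0 1] by auto
  then have "continuous_on {0..1} (\<lambda>t. \<gamma> 0 + integral {0..t} ?F)"
    by (intro continuous_intros indefinite_integral_continuous_1)
  moreover have "\<gamma> 0 + integral {0..t} ?F = \<gamma> t" if "t \<in> {0..1}" for t
    using horizontal_integral[OF assms, of 0 t] that by (simp add: integral_unique)
  ultimately show ?thesis by (metis (no_types, lifting) continuous_on_cong)
qed

text \<open>The inscribed polygon is no longer than the curve. Its vertical error is at most the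
  oscillation of the horizontal part on short intervals times the length. The term with
  \<open>B\<close> translates the start of the curve to the identity.\<close>

lemma horizontal_polygon_approx:
  assumes hor: "horizontal B \<gamma> u" and "\<eta> > 0"
  shows "\<exists>N\<ge>1. \<exists>\<xi>. psum \<xi> N = fst (\<gamma> 1) - fst (\<gamma> 0) \<and>
    norm (snd (\<gamma> 1) - snd (\<gamma> 0) - B (fst (\<gamma> 0)) (fst (\<gamma> 1)) - area B \<xi> \<xi> N) \<le> \<eta> \<and>
    (\<Sum>j<N. norm (\<xi> j)) \<le> integral {0..1} (\<lambda>s. norm (u s))"
proof -
  define x where "x s = fst (\<gamma> s)" for s
  define L where "L = integral {0..1} (\<lambda>s. norm (u s))"
  have absu: "u absolutely_integrable_on {0..1}" using hor by (simp add: horizontal_def)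
  then have nu: "(\<lambda>s. norm (u s)) integrable_on {0..1}"
    by (simp add: absolutely_integrable_on_def)
  have L: "L \<ge> 0" unfolding L_def by (rule integral_nonneg[OF nu]) auto
  \<comment> \<open>Chosen so that the total error \<open>bracket_bound * \<omega> * L\<close> is at
    most \<open>\<eta>\<close>; \<open>L + 1\<close> avoids division by zero for constant
    curves.\<close>
  define \<omega> where "\<omega> = \<eta> / (bracket_bound * (L + 1))"
  have \<omega>: "\<omega> > 0" using \<open>\<eta> > 0\<close> bracket_bound_pos L by (simp add: \<omega>_def)
  have "uniformly_continuous_on {0..1} x"
    unfolding x_def
    by (intro compact_uniformly_continuous continuous_on_fst horizontal_continuous[OF hor]) auto
  then obtain \<delta> where \<delta>: "\<delta> > 0" "\<And>s t. s \<in> {0..1} \<Longrightarrow> t \<in> {0..1} \<Longrightarrow> dist s t < \<delta> \<Longrightarrow> dist (x s) (x t) < \<omega>"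
    using \<omega> unfolding uniformly_continuous_on_def by metis
  obtain N where N: "1 / \<delta> < real N" using reals_Archimedean2 by blast
  have N0: "real N > 0" using N \<delta>(1) by (meson less_trans zero_less_divide_1_iff)
  have N\<delta>: "1 / real N < \<delta>" using N N0 \<delta>(1) by (simp add: field_simps)
  define \<tau> where "\<tau> j = real j / real N" for j
  have \<tau>: "0 \<le> \<tau> j" "\<tau> j \<le> \<tau> (Suc j)" "\<tau> (Suc j) - \<tau> j = 1 / real N" for j
    using N0 by (auto simp: \<tau>_def field_simps)
  have \<tau>1: "\<tau> j \<le> 1" if "j \<le> N" for j using that N0 by (simp add: \<tau>_def)
  define \<xi> where "\<xi> j = x (\<tau> (Suc j)) - x (\<tau> j)" for j
  have ps: "psum \<xi> j = x (\<tau> j) - x 0" for j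
    by (induction j) (auto simp: \<xi>_def \<tau>_def)
  have \<tau>N: "\<tau> N = 1" using N0 by (simp add: \<tau>_def)
  define I where "I j = integral {\<tau> j..\<tau> (Suc j)} (\<lambda>s. norm (u s))" for j
  have nuj: "(\<lambda>s. norm (u s)) integrable_on {a..b}" if "0 \<le> a" "b \<le> 1" for a b
    by (rule integrable_on_subinterval[OF nu]) (use that in auto)
  have sumI: "(\<Sum>j<n. I j) = integral {0..\<tau> n} (\<lambda>s. norm (u s))" if "n \<le> N" for n
    using that
  proof (induction n)
    case 0 then show ?case by (simp add: \<tau>_def)
  next
    case (Suc n)
    then show ?case using \<tau> \<tau>1[of "Suc n"]
      by (simp add: I_def) (intro Henstock_Kurzweil_Integration.integral_combine nuj, auto)
  qed
  \<comment> \<open>The vertical error on one interval, which equals the integral of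
    \<open>B (x s - x (\<tau> j)) (u s)\<close>.\<close>
  define D where "D j = snd (\<gamma> (\<tau> (Suc j))) - snd (\<gamma> (\<tau> j)) - B (x (\<tau> j)) (\<xi> j)" for j
  have bounds: "norm (\<xi> j) \<le> I j \<and> norm (D j) \<le> bracket_bound * \<omega> * I j" if j: "j < N" for j
  proof -
    have j1: "\<tau> (Suc j) \<le> 1" using \<tau>1 j by simp
    note hi = horizontal_integral[OF hor \<tau>(1)[of j] \<tau>(2)[of j] j1]
    have iu: "(u has_integral \<xi> j) {\<tau> j..\<tau> (Suc j)}"
      using has_integral_linear[OF hi bounded_linear_fst] by (simp add: o_def \<xi>_def x_def)
    have iB: "((\<lambda>s. B (x s) (u s)) has_integral (snd (\<gamma> (\<tau> (Suc j))) - snd (\<gamma> (\<tau> j)))) {\<tau> j..\<tau> (Suc j)}"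
      using has_integral_linear[OF hi bounded_linear_snd] by (simp add: o_def x_def)
    have "bounded_linear (B (x (\<tau> j)))" using linear_B_right linear_conv_bounded_linear by blast
    from has_integral_linear[OF iu this]
    have iB0: "((\<lambda>s. B (x (\<tau> j)) (u s)) has_integral B (x (\<tau> j)) (\<xi> j)) {\<tau> j..\<tau> (Suc j)}" by (simp add: o_def)
    have iD: "((\<lambda>s. B (x s - x (\<tau> j)) (u s)) has_integral D j) {\<tau> j..\<tau> (Suc j)}"
      using has_integral_diff[OF iB iB0] by (simp add: D_def B_simps)
    have nI: "(\<lambda>s. norm (u s)) integrable_on {\<tau> j..\<tau> (Suc j)}" using \<tau> j1 by (intro nuj)
    have "norm (integral {\<tau> j..\<tau> (Suc j)} u) \<le> I j"
      unfolding I_def using iu nI by (intro integral_norm_bound_integral) auto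
    moreover have "norm (integral {\<tau> j..\<tau> (Suc j)} (\<lambda>s. B (x s - x (\<tau> j)) (u s)))
        \<le> integral {\<tau> j..\<tau> (Suc j)} (\<lambda>s. (bracket_bound * \<omega>) * norm (u s))"
    proof (rule integral_norm_bound_integral)
      fix s assume s: "s \<in> {\<tau> j..\<tau> (Suc j)}"
      have "dist s (\<tau> j) < \<delta>" using s \<tau>(3)[of j] N\<delta> by (auto simp: dist_real_def)
      then have "norm (x s - x (\<tau> j)) \<le> \<omega>"
        using \<delta>(2)[of s "\<tau> j"] s \<tau>(1)[of j] \<tau>(2)[of j] j1 by (auto simp: dist_norm)
      then have "bracket_bound * norm (x s - x (\<tau> j)) * norm (u s) \<le> bracket_bound * \<omega> * norm (u s)"
        using bracket_bound_pos by (intro mult_right_mono mult_left_mono) auto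
      then show "norm (B (x s - x (\<tau> j)) (u s)) \<le> bracket_bound * \<omega> * norm (u s)"
        using norm_B_le order_trans by blast
    next
      show "(\<lambda>s. bracket_bound * \<omega> * norm (u s)) integrable_on {\<tau> j..\<tau> (Suc j)}"
        using nI by (rule integrable_on_mult_right)
    qed (use iD in auto)
    ultimately show ?thesis using iu iD by (simp add: integral_unique I_def)
  qed
  have lenle: "(\<Sum>j<N. norm (\<xi> j)) \<le> L"
  proof -
    have "(\<Sum>j<N. norm (\<xi> j)) \<le> (\<Sum>j<N. I j)" using bounds by (intro sum_mono) auto
    then show ?thesis using sumI[of N] by (simp add: \<tau>N L_def)
  qed
  have tel: "(\<Sum>j<n. snd (\<gamma> (\<tau> (Suc j))) - snd (\<gamma> (\<tau> j))) = snd (\<gamma> (\<tau> n)) - snd (\<gamma> 0)" for n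
    by (induction n) (auto simp: \<tau>_def)
  have "area B \<xi> \<xi> N = (\<Sum>j<N. B (x (\<tau> j)) (\<xi> j)) - B (x 0) (psum \<xi> N)"
  proof -
    have "area B \<xi> \<xi> N = (\<Sum>j<N. B (x (\<tau> j)) (\<xi> j) - B (x 0) (\<xi> j))"
      by (simp add: area_def ps B_simps)
    then show ?thesis by (simp add: sum_subtractf psum_def B_sum_right)
  qed
  moreover have "B (x 0) (psum \<xi> N) = B (x 0) (x 1)" by (simp add: ps \<tau>N B_simps)
  ultimately have "snd (\<gamma> 1) - snd (\<gamma> 0) - B (x 0) (x 1) - area B \<xi> \<xi> N = (\<Sum>j<N. D j)"
    using tel[of N] by (simp add: D_def sum_subtractf \<tau>N)
  moreover have "norm (\<Sum>j<N. D j) \<le> \<eta>"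
  proof -
    have "norm (\<Sum>j<N. D j) \<le> (\<Sum>j<N. bracket_bound * \<omega> * I j)" using bounds by (intro sum_norm_le) auto
    also have "\<dots> = bracket_bound * \<omega> * L" using sumI[of N] by (simp add: sum_distrib_left[symmetric] \<tau>N L_def)
    also have "\<dots> = \<eta> * (L / (L + 1))" using bracket_bound_pos by (simp add: \<omega>_def)
    also have "\<dots> \<le> \<eta> * 1" using \<open>\<eta> > 0\<close> L by (intro mult_left_mono) auto
    finally show ?thesis by simp
  qed
  ultimately show ?thesis
    using lenle N0 ps[of N] by (intro exI[of _ N] conjI exI[of _ \<xi>]) (auto simp: \<tau>N x_def L_def)
qed

text \<open>Lists suit concatenation, reversal and cutting edges into different numbers of pieces:
  these become product, inverse and identity for the endpoint.\<close>

definition poly_end :: "(real^'m) list \<Rightarrow> (real^'m) \<times> (real^'k)" where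
  "poly_end l = (psum ((!) l) (length l), area B ((!) l) ((!) l) (length l))"

lemma poly_end_Nil [simp]: "poly_end [] = 0"
  by (simp add: poly_end_def zero_prod_def)

lemma poly_end_snoc: "poly_end (l @ [v]) = gmult B (poly_end l) (v, 0)"
proof -
  have "psum ((!) (l @ [v])) (length l) = psum ((!) l) (length l)"
    by (rule psum_cong) (simp add: nth_append)
  moreover have "area B ((!) (l @ [v])) ((!) (l @ [v])) (length l) = area B ((!) l) ((!) l) (length l)"
    by (rule area_cong) (simp add: nth_append)
  ultimately show ?thesis by (simp add: poly_end_def gmult_def)
qed

lemma poly_end_append: "poly_end (l @ l') = gmult B (poly_end l) (poly_end l')"
proof (induction l' rule: rev_induct)
  case Nil then show ?case by (simp add: gmult_def B_simps zero_prod_def prod_eq_iff)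
next
  case (snoc v l')
  then show ?case using poly_end_snoc[of "l @ l'" v] by (simp add: poly_end_snoc gmult_assoc)
qed

lemma poly_end_single: "poly_end [v] = (v, 0)"
  by (simp add: poly_end_def B_simps)

lemma poly_end_replicate: "poly_end (replicate k v) = (real k *\<^sub>R v, 0)"
proof (induction k)
  case (Suc k)
  have "poly_end (replicate (Suc k) v) = gmult B (poly_end (replicate k v)) (v, 0)"
    using poly_end_snoc[of "replicate k v" v] by (simp add: replicate_append_same)
  then show ?case by (simp add: Suc gmult_def B_simps algebra_simps)
qed (simp add: zero_prod_def)

lemma poly_end_rev: "poly_end (rev (map uminus l)) = - poly_end l"
proof (induction l rule: rev_induct)
  case (snoc v l)
  have "poly_end (rev (map uminus (l @ [v]))) = gmult B (- v, 0) (- poly_end l)"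
    using poly_end_append[of "[- v]" "rev (map uminus l)"] by (simp add: snoc poly_end_single)
  also have "\<dots> = - poly_end (l @ [v])"
    unfolding poly_end_snoc using skew[of v "fst (poly_end l)"] by (simp add: gmult_def B_simps prod_eq_iff)
  finally show ?case .
qed simp

text \<open>Squared length and energy agree at constant speed. Cutting each edge \<open>v\<close>
  into about \<open>K * norm v\<close> pieces makes the pieces nearly equal in length, apart from
  rounding, whose effect vanishes as \<open>K\<close> grows.\<close>

lemma equalise_polygon:
  assumes "\<epsilon> > 0"
  shows "\<exists>N\<ge>N0. \<exists>\<xi>. N \<ge> 1 \<and> (psum \<xi> N, area B \<xi> \<xi> N) = poly_end l \<and>
    energy \<xi> N \<le> (\<Sum>v\<leftarrow>l. norm v)\<^sup>2 + \<epsilon>"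
proof -
  \<comment> \<open>The zero edge guarantees a nonempty polygon without altering endpoint or
    length.\<close>
  define l0 where "l0 = 0 # l"
  define L where "L = (\<Sum>v\<leftarrow>l0. norm v)"
  have L0: "L \<ge> 0" unfolding L_def by (rule sum_list_nonneg) auto
  \<comment> \<open>Rounding up costs at most one piece per edge, so the excess energy is at most
    \<open>length l0 * L / K\<close>, which must not exceed \<open>\<epsilon>\<close>.\<close>
  define K where "K = (real (length l0) * L + 1) / \<epsilon>"
  have K: "K > 0" using L0 assms by (simp add: K_def add_nonneg_pos)
  define k where "k v = nat \<lfloor>K * norm v\<rfloor> + 1" for v :: "real^'m"
  have k1: "real (k v) \<le> K * norm v + 1" "K * norm v \<le> real (k v)" "k v > 0" for v
  proof -
    have "real (nat \<lfloor>K * norm v\<rfloor>) = of_int \<lfloor>K * norm v\<rfloor>" using K by (simp add: of_nat_nat)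
    then show "real (k v) \<le> K * norm v + 1" "K * norm v \<le> real (k v)" "k v > 0"
      unfolding k_def by (simp_all, linarith+)
  qed
  define cut where "cut v = replicate (k v) (v /\<^sub>R real (k v))" for v
  have pe: "poly_end (concat (map cut xs)) = poly_end xs" for xs
  proof (induction xs)
    case (Cons v xs)
    have "poly_end (cut v) = poly_end [v]"
      using k1(3)[of v] by (simp add: cut_def poly_end_replicate poly_end_single)
    then show ?case using poly_end_append[of "[v]" xs] Cons by (simp add: poly_end_append)
  qed simp
  have len: "real (length (concat (map cut xs))) \<le> K * (\<Sum>v\<leftarrow>xs. norm v) + real (length xs)" for xs
  proof (induction xs)
    case (Cons v xs)
    have "real (length (cut v)) \<le> K * norm v + 1" using k1(1) by (simp add: cut_def)
    then show ?case using Cons by (simp add: algebra_simps)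
  qed simp
  have sq: "K * (\<Sum>v\<leftarrow>concat (map cut xs). (norm v)\<^sup>2) \<le> (\<Sum>v\<leftarrow>xs. norm v)" for xs
  proof (induction xs)
    case (Cons v xs)
    have "(\<Sum>v\<leftarrow>cut v. (norm v)\<^sup>2) = (norm v)\<^sup>2 / real (k v)"
      using k1(3)[of v] by (simp add: cut_def sum_list_replicate power_mult_distrib power2_eq_square divide_simps)
    moreover have "K * ((norm v)\<^sup>2 / real (k v)) \<le> norm v"
    proof -
      have "K * (norm v)\<^sup>2 \<le> norm v * real (k v)"
        using mult_right_mono[OF k1(2)[of v], of "norm v"] by (simp add: power2_eq_square mult_ac)
      then show ?thesis using k1(3)[of v] by (simp add: divide_simps)
    qed
    ultimately show ?case using Cons by (simp add: distrib_left)
  qed simp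
  define l1 where "l1 = concat (map cut l0)"
  define n where "n = length l1"
  have "length (cut 0) > 0" using k1(3) by (simp add: cut_def)
  then have n1: "n \<ge> 1" unfolding n_def l1_def l0_def by (simp add: Suc_le_eq)
  have "energy ((!) l1) n \<le> L\<^sup>2 + \<epsilon>"
  proof -
    have "(\<Sum>j<n. (norm (l1 ! j))\<^sup>2) = (\<Sum>v\<leftarrow>l1. (norm v)\<^sup>2)"
      by (simp add: n_def sum_list_sum_nth lessThan_atLeast0)
    then have e: "energy ((!) l1) n = real n * (\<Sum>v\<leftarrow>l1. (norm v)\<^sup>2)" by (simp add: energy_def)
    have s: "(\<Sum>v\<leftarrow>l1. (norm v)\<^sup>2) \<le> L / K" using sq[of l0] K by (simp add: l1_def L_def field_simps)
    have "energy ((!) l1) n \<le> (K * L + real (length l0)) * (L / K)"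
      unfolding e using len[of l0] K L0 by (intro mult_mono s) (auto simp: n_def l1_def L_def intro!: sum_list_nonneg)
    also have "\<dots> = L\<^sup>2 + (real (length l0) * L) / K" using K by (simp add: field_simps power2_eq_square)
    also have "(real (length l0) * L) / K \<le> \<epsilon>"
      using K assms L0 by (simp add: K_def divide_simps)
    finally show ?thesis by simp
  qed
  \<comment> \<open>A last uniform refinement only serves to reach at least \<open>N0\<close>
    edges.\<close>
  moreover define M where "M = Suc N0"
  have M: "M > 0" by (simp add: M_def)
  moreover have "(psum (refine_poly M ((!) l1)) (n * M), area B (refine_poly M ((!) l1)) (refine_poly M ((!) l1)) (n * M)) = poly_end l"
  proof -
    have "poly_end l0 = poly_end l"
      using poly_end_append[of "[0]" l] by (simp add: l0_def poly_end_single gmult_def B_simps)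
    then have "poly_end l1 = poly_end l" by (simp add: l1_def pe)
    then show ?thesis using psum_refine[OF M, of 0 "(!) l1" n] area_refine[OF M, of "(!) l1" n]
      by (simp add: poly_end_def n_def)
  qed
  moreover have "n * M \<ge> N0" "n * M \<ge> 1" using mult_le_mono1[OF n1, of M] by (simp_all add: M_def)
  moreover have "L = (\<Sum>v\<leftarrow>l. norm v)" by (simp add: L_def l0_def)
  ultimately show ?thesis
    by (intro exI[of _ "n * M"] conjI exI[of _ "refine_poly M ((!) l1)"]) (simp_all add: energy_refine)
qed

end

lemma length_sq_le_energy: "(\<Sum>j<N. norm (\<xi> j))\<^sup>2 \<le> energy \<xi> N"
  using sum_squared_le_sum_of_squares[of "\<lambda>j. norm (\<xi> j)" "{..<N}"]
  by (simp add: energy_def mult.commute)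

context step2 begin

lemma gmult_0 [simp]: "gmult B 0 w = w" "gmult B w 0 = w"
  by (simp_all add: gmult_def B_simps)

lemma cc_set_bdd: "bdd_below {integral {0..1} (\<lambda>s. norm (u s)) | \<gamma> u.
       horizontal B \<gamma> u \<and> \<gamma> 0 = p \<and> \<gamma> 1 = q}"
  by (rule bdd_belowI[of _ 0])
     (auto intro!: integral_nonneg simp: horizontal_def absolutely_integrable_on_def)

lemma cc_dist_le_length:
  assumes "N \<ge> 1" "psum \<xi> N = fst w" "area B \<xi> \<xi> N = snd w"
  shows "cc_dist B p (gmult B p w) \<le> (\<Sum>j<N. norm (\<xi> j))"
proof -
  obtain \<gamma> u where "horizontal B \<gamma> u" "\<gamma> 0 = p" "\<gamma> 1 = gmult B p w"
    "integral {0..1} (\<lambda>s. norm (u s)) = (\<Sum>j<N. norm (\<xi> j))"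
    using polygon_horizontal[OF assms] by blast
  then show ?thesis unfolding cc_dist_def by (intro cInf_lower cc_set_bdd) (auto intro!: exI)
qed

text \<open>One edge reaches the horizontal part and a vertical shift supplies the rest. This gives
  connectivity by horizontal curves, so the infimum defining \<open>cc_dist\<close> is over a
  nonempty set.\<close>

lemma polygon_exists: "\<exists>N\<ge>1. \<exists>\<xi>. psum \<xi> N = fst w \<and> area B \<xi> \<xi> N = snd w \<and>
    energy \<xi> N \<le> (norm (fst w))\<^sup>2 + shift_cost * norm (snd w)"
proof -
  have "\<exists>N'\<ge>1. \<exists>\<xi>'. psum \<xi>' N' = psum (\<lambda>_. fst w) 1 \<and>
      area B \<xi>' \<xi>' N' = area B (\<lambda>_. fst w) (\<lambda>_. fst w) 1 + snd w \<and>
      energy \<xi>' N' \<le> energy (\<lambda>_. fst w) 1 + shift_cost * norm (snd w)"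
    using shiftable_shift_cost[of "snd w"] unfolding shiftable_def by (metis order_refl)
  then show ?thesis by (simp add: B_simps energy_def)
qed

lemma cc_set_nonempty: "{integral {0..1} (\<lambda>s. norm (u s)) | \<gamma> u.
       horizontal B \<gamma> u \<and> \<gamma> 0 = p \<and> \<gamma> 1 = gmult B p w} \<noteq> {}"
proof -
  obtain N \<xi> where "N \<ge> 1" "psum \<xi> N = fst w" "area B \<xi> \<xi> N = snd w" using polygon_exists by blast
  then show ?thesis using polygon_horizontal[of N \<xi> w p] by blast
qed

lemma cc_dist_nonneg: "0 \<le> cc_dist B p q"
proof -
  have "q = gmult B p (gmult B (- p) q)" by (simp add: gmult_inverse)
  then show ?thesis unfolding cc_dist_def using cc_set_nonempty[of p "gmult B (- p) q"]
    by (intro cInf_greatest) (auto intro!: integral_nonneg simp: horizontal_def absolutely_integrable_on_def)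
qed

lemma cc_dist_sq_le_energy:
  assumes "N \<ge> 1" "psum \<xi> N = fst w" "area B \<xi> \<xi> N = snd w"
  shows "(cc_dist B p (gmult B p w))\<^sup>2 \<le> energy \<xi> N"
  using power_mono[OF cc_dist_le_length[OF assms, of p] cc_dist_nonneg, of 2] length_sq_le_energy[of \<xi> N]
  by linarith

text \<open>A nearly shortest curve is replaced by an inscribed polygon, which is brought to nearly
  constant speed and then shifted vertically to remove its endpoint error.\<close>

lemma cc_dist_energy_approx:
  assumes \<epsilon>: "\<epsilon> > 0"
  shows "\<exists>N\<ge>N0. \<exists>\<xi>. N \<ge> 1 \<and> psum \<xi> N = fst w \<and> area B \<xi> \<xi> N = snd w \<and>
    energy \<xi> N \<le> (cc_dist B p (gmult B p w))\<^sup>2 + \<epsilon>"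
proof -
  define d where "d = cc_dist B p (gmult B p w)"
  have d0: "d \<ge> 0" by (simp add: d_def cc_dist_nonneg)
  \<comment> \<open>Squaring \<open>d + \<eta>\<close> costs at most
    \<open>(2 * d + 1) * \<eta>\<close>, equalising costs \<open>\<eta>\<close>, and the shift
    \<open>shift_cost * \<eta>\<close>.\<close>
  define \<eta> where "\<eta> = min 1 (\<epsilon> / (2 * d + 2 + shift_cost))"
  have \<eta>: "\<eta> > 0" "\<eta> \<le> 1" "\<eta> * (2 * d + 2 + shift_cost) \<le> \<epsilon>"
  proof -
    have D: "2 * d + 2 + shift_cost > 0" using d0 shift_cost_pos by linarith
    show "\<eta> > 0" "\<eta> \<le> 1" using \<epsilon> D by (auto simp: \<eta>_def)
    have "\<eta> \<le> \<epsilon> / (2 * d + 2 + shift_cost)" by (simp add: \<eta>_def)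
    then show "\<eta> * (2 * d + 2 + shift_cost) \<le> \<epsilon>" using D by (simp only: pos_le_divide_eq)
  qed
  obtain \<gamma> u where hor: "horizontal B \<gamma> u" "\<gamma> 0 = p" "\<gamma> 1 = gmult B p w"
    and len: "integral {0..1} (\<lambda>s. norm (u s)) < d + \<eta>"
    using cInf_lessD[OF cc_set_nonempty[of p w], of "d + \<eta>"] \<eta>(1) unfolding d_def cc_dist_def by auto
  obtain N1 \<xi>1 where N1: "N1 \<ge> 1" "psum \<xi>1 N1 = fst (\<gamma> 1) - fst (\<gamma> 0)"
    and a1: "norm (snd (\<gamma> 1) - snd (\<gamma> 0) - B (fst (\<gamma> 0)) (fst (\<gamma> 1)) - area B \<xi>1 \<xi>1 N1) \<le> \<eta>"
    and l1: "(\<Sum>j<N1. norm (\<xi>1 j)) \<le> integral {0..1} (\<lambda>s. norm (u s))"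
    using horizontal_polygon_approx[OF hor(1) \<eta>(1)] by blast
  define l where "l = map \<xi>1 [0..<N1]"
  have pe: "poly_end l = (psum \<xi>1 N1, area B \<xi>1 \<xi>1 N1)"
    unfolding poly_end_def l_def by (auto intro!: psum_cong area_cong)
  have ll: "(\<Sum>v\<leftarrow>l. norm v) = (\<Sum>j<N1. norm (\<xi>1 j))"
    by (simp add: l_def o_def interv_sum_list_conv_sum_set_nat lessThan_atLeast0)
  define e where "e = snd w - area B \<xi>1 \<xi>1 N1"
  have ne: "norm e \<le> \<eta>" using a1 hor(2,3) by (simp add: e_def gmult_def B_simps)
  obtain N2 \<xi>2 where N2: "N2 \<ge> N0" "N2 \<ge> 1" "(psum \<xi>2 N2, area B \<xi>2 \<xi>2 N2) = poly_end l"
     "energy \<xi>2 N2 \<le> (\<Sum>v\<leftarrow>l. norm v)\<^sup>2 + \<eta>"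
    using equalise_polygon[OF \<eta>(1)] by blast
  obtain N3 \<xi>3 where N3: "N3 \<ge> N2" "psum \<xi>3 N3 = psum \<xi>2 N2" "area B \<xi>3 \<xi>3 N3 = area B \<xi>2 \<xi>2 N2 + e"
     "energy \<xi>3 N3 \<le> energy \<xi>2 N2 + shift_cost * norm e"
    using shiftable_shift_cost[of e] N2(2) unfolding shiftable_def by blast
  have "psum \<xi>3 N3 = fst w" using N3 N2 pe N1 hor by (simp add: gmult_def)
  moreover have "area B \<xi>3 \<xi>3 N3 = snd w" using N3 N2 pe by (simp add: e_def)
  moreover have "energy \<xi>3 N3 \<le> d\<^sup>2 + \<epsilon>"
  proof -
    have "(\<Sum>v\<leftarrow>l. norm v)\<^sup>2 \<le> (d + \<eta>)\<^sup>2"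
      using ll l1 len by (intro power_mono) (auto intro: sum_nonneg)
    moreover have "shift_cost * norm e \<le> shift_cost * \<eta>" using ne shift_cost_pos by simp
    moreover have "\<eta> * \<eta> \<le> \<eta>" using \<eta>(1,2) mult_left_mono[of \<eta> 1 \<eta>] by simp
    ultimately have "energy \<xi>3 N3 \<le> d\<^sup>2 + \<eta> * (2 * d + 2 + shift_cost)"
      using N3(4) N2(4) by (simp add: power2_eq_square algebra_simps)
    then show ?thesis using \<eta>(3) by simp
  qed
  ultimately show ?thesis using N2 N3 unfolding d_def by (intro exI[of _ N3] conjI exI[of _ \<xi>3]) auto
qed

lemma cc_dist_le_list: "cc_dist B p (gmult B p (poly_end l)) \<le> (\<Sum>v\<leftarrow>l. norm v)"
proof -
  define l0 where "l0 = 0 # l"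
  have "poly_end l0 = poly_end l"
    using poly_end_append[of "[0]" l] by (simp add: l0_def poly_end_single gmult_def B_simps)
  then have "cc_dist B p (gmult B p (poly_end l)) \<le> (\<Sum>j<length l0. norm (l0 ! j))"
    by (intro cc_dist_le_length) (auto simp: l0_def poly_end_def)
  also have "\<dots> = (\<Sum>v\<leftarrow>l0. norm v)"
    by (simp add: sum_list_sum_nth lessThan_atLeast0)
  finally show ?thesis by (simp add: l0_def)
qed

lemma cc_dist_list_approx:
  assumes \<epsilon>: "\<epsilon> > 0"
  shows "\<exists>l. poly_end l = w \<and> (\<Sum>v\<leftarrow>l. norm v) \<le> cc_dist B p (gmult B p w) + \<epsilon>"
proof -
  let ?d = "cc_dist B p (gmult B p w)"
  obtain N \<xi> where N: "psum \<xi> N = fst w" "area B \<xi> \<xi> N = snd w" "energy \<xi> N \<le> ?d\<^sup>2 + \<epsilon>\<^sup>2"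
    using cc_dist_energy_approx[of "\<epsilon>\<^sup>2" 0 w p] \<epsilon> by auto
  define l where "l = map \<xi> [0..<N]"
  have "poly_end l = (psum \<xi> N, area B \<xi> \<xi> N)"
    unfolding poly_end_def l_def by (auto intro!: psum_cong area_cong)
  moreover have "(\<Sum>v\<leftarrow>l. norm v) = (\<Sum>j<N. norm (\<xi> j))"
    by (simp add: l_def o_def interv_sum_list_conv_sum_set_nat lessThan_atLeast0)
  moreover have "(\<Sum>j<N. norm (\<xi> j)) \<le> ?d + \<epsilon>"
  proof (rule power2_le_imp_le)
    have "(\<Sum>j<N. norm (\<xi> j))\<^sup>2 \<le> ?d\<^sup>2 + \<epsilon>\<^sup>2" using length_sq_le_energy[of \<xi> N] N(3) by linarith
    also have "\<dots> \<le> (?d + \<epsilon>)\<^sup>2" using \<epsilon> cc_dist_nonneg[of p "gmult B p w"] by (simp add: power2_sum)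
    finally show "(\<Sum>j<N. norm (\<xi> j))\<^sup>2 \<le> (?d + \<epsilon>)\<^sup>2" .
  qed (use \<epsilon> cc_dist_nonneg[of p "gmult B p w"] in simp)
  ultimately show ?thesis using N by (intro exI[of _ l]) auto
qed

section \<open>Left invariance and the distance from the identity\<close>

definition cc_norm :: "(real^'m) \<times> (real^'k) \<Rightarrow> real" where "cc_norm w = cc_dist B 0 w"

text \<open>Polygons are described by increments, so the same nearly shortest one can be started at
  any base point.\<close>

lemma cc_dist_translate: "cc_dist B p (gmult B p w) \<le> cc_dist B q (gmult B q w)"
proof (rule field_le_epsilon)
  fix \<epsilon> :: real assume "\<epsilon> > 0"
  then obtain l where "poly_end l = w" "(\<Sum>v\<leftarrow>l. norm v) \<le> cc_dist B q (gmult B q w) + \<epsilon>"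
    using cc_dist_list_approx by blast
  then show "cc_dist B p (gmult B p w) \<le> cc_dist B q (gmult B q w) + \<epsilon>"
    using cc_dist_le_list[of p l] by simp
qed

lemma cc_dist_eq: "cc_dist B p q = cc_norm (gmult B (- p) q)"
proof -
  have "cc_dist B p (gmult B p (gmult B (- p) q)) = cc_dist B 0 (gmult B 0 (gmult B (- p) q))"
    by (intro antisym cc_dist_translate)
  then show ?thesis by (simp add: gmult_inverse cc_norm_def)
qed

lemma cc_norm_nonneg: "0 \<le> cc_norm w"
  by (simp add: cc_norm_def cc_dist_nonneg)

lemma cc_norm_le_list: "cc_norm (poly_end l) \<le> (\<Sum>v\<leftarrow>l. norm v)"
  using cc_dist_le_list[of 0 l] by (simp add: cc_norm_def)

lemma cc_norm_list_approx: "\<epsilon> > 0 \<Longrightarrow> \<exists>l. poly_end l = w \<and> (\<Sum>v\<leftarrow>l. norm v) \<le> cc_norm w + \<epsilon>"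
  using cc_dist_list_approx[of \<epsilon> w 0] by (simp add: cc_norm_def)

lemma cc_norm_sq_le_energy: "N \<ge> 1 \<Longrightarrow> psum \<xi> N = fst w \<Longrightarrow> area B \<xi> \<xi> N = snd w \<Longrightarrow> (cc_norm w)\<^sup>2 \<le> energy \<xi> N"
  using cc_dist_sq_le_energy[of N \<xi> w 0] by (simp add: cc_norm_def)

lemma cc_norm_energy_approx: "\<epsilon> > 0 \<Longrightarrow> \<exists>N\<ge>N0. \<exists>\<xi>. N \<ge> 1 \<and> psum \<xi> N = fst w \<and> area B \<xi> \<xi> N = snd w \<and>
    energy \<xi> N \<le> (cc_norm w)\<^sup>2 + \<epsilon>"
  using cc_dist_energy_approx[of \<epsilon> N0 w 0] by (simp add: cc_norm_def)

lemma cc_norm_triangle: "cc_norm (gmult B w w') \<le> cc_norm w + cc_norm w'"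
proof (rule field_le_epsilon)
  fix \<epsilon> :: real assume "\<epsilon> > 0"
  then have "\<epsilon> / 2 > 0" by simp
  then obtain l l' where "poly_end l = w" "(\<Sum>v\<leftarrow>l. norm v) \<le> cc_norm w + \<epsilon> / 2"
    "poly_end l' = w'" "(\<Sum>v\<leftarrow>l'. norm v) \<le> cc_norm w' + \<epsilon> / 2"
    using cc_norm_list_approx by metis
  then show "cc_norm (gmult B w w') \<le> cc_norm w + cc_norm w' + \<epsilon>"
    using cc_norm_le_list[of "l @ l'"] by (simp add: poly_end_append)
qed

lemma cc_norm_minus: "cc_norm (- w) = cc_norm w"
proof -
  have "cc_norm (- w) \<le> cc_norm w" for w
  proof (rule field_le_epsilon)
    fix \<epsilon> :: real assume "\<epsilon> > 0"
    then obtain l where l: "poly_end l = w" "(\<Sum>v\<leftarrow>l. norm v) \<le> cc_norm w + \<epsilon>"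
      using cc_norm_list_approx by metis
    have "(\<Sum>v\<leftarrow>rev (map uminus l). norm v) = (\<Sum>v\<leftarrow>l. norm v)"
      by (simp add: rev_map[symmetric] sum_list_rev o_def)
    then show "cc_norm (- w) \<le> cc_norm w + \<epsilon>"
      using l cc_norm_le_list[of "rev (map uminus l)"] by (simp add: poly_end_rev)
  qed
  from this[of w] this[of "- w"] show ?thesis by simp
qed

lemma cc_norm_sq_le: "(cc_norm w)\<^sup>2 \<le> (norm (fst w))\<^sup>2 + shift_cost * norm (snd w)"
proof -
  obtain N \<xi> where "N \<ge> 1" "psum \<xi> N = fst w" "area B \<xi> \<xi> N = snd w"
    "energy \<xi> N \<le> (norm (fst w))\<^sup>2 + shift_cost * norm (snd w)" using polygon_exists by blast
  then show ?thesis using cc_norm_sq_le_energy[of N \<xi> w] by linarith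
qed

text \<open>The vertical Lipschitz bound in the form used for variations: a competitor must hit the
  horizontal endpoint exactly, while an area error is only penalised linearly.\<close>

lemma cc_norm_sq_le_shifted:
  assumes "N \<ge> 1" "psum \<xi> N = fst w"
  shows "(cc_norm w)\<^sup>2 \<le> energy \<xi> N + shift_cost * norm (snd w - area B \<xi> \<xi> N)"
proof -
  obtain N' \<xi>' where "N' \<ge> N" "psum \<xi>' N' = psum \<xi> N"
    "area B \<xi>' \<xi>' N' = area B \<xi> \<xi> N + (snd w - area B \<xi> \<xi> N)"
    "energy \<xi>' N' \<le> energy \<xi> N + shift_cost * norm (snd w - area B \<xi> \<xi> N)"
    using shiftable_shift_cost[of "snd w - area B \<xi> \<xi> N"] assms(1) unfolding shiftable_def by blast
  then show ?thesis using assms cc_norm_sq_le_energy[of N' \<xi>' w] by auto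
qed

section \<open>First variation of the area and the approximate Euler-Lagrange equation\<close>

definition mid :: "(nat \<Rightarrow> real^'m) \<Rightarrow> nat \<Rightarrow> real^'m" where
  "mid \<xi> j = psum \<xi> j + (1/2) *\<^sub>R \<xi> j"

text \<open>This is the first variation of the area at \<open>\<xi>\<close> in direction
  \<open>\<eta>\<close>. Skew symmetry moves the increments of \<open>\<eta>\<close> into the second
  slot, at the price of a boundary term; the midpoints come from the diagonal.\<close>

lemma area_cross:
  "area B \<xi> \<eta> N + area B \<eta> \<xi> N = 2 *\<^sub>R (\<Sum>j<N. B (mid \<xi> j) (\<eta> j)) - B (psum \<xi> N) (psum \<eta> N)"
proof (induction N)
  case (Suc N)
  have "area B \<xi> \<eta> (Suc N) + area B \<eta> \<xi> (Suc N)
      = (area B \<xi> \<eta> N + area B \<eta> \<xi> N) + B (psum \<xi> N) (\<eta> N) + B (psum \<eta> N) (\<xi> N)" by simp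
  also have "\<dots> = 2 *\<^sub>R (\<Sum>j<N. B (mid \<xi> j) (\<eta> j)) - B (psum \<xi> N) (psum \<eta> N) + B (psum \<xi> N) (\<eta> N) - B (\<xi> N) (psum \<eta> N)"
    unfolding Suc by (subst (4) skew) simp
  also have "\<dots> = 2 *\<^sub>R (\<Sum>j<Suc N. B (mid \<xi> j) (\<eta> j)) - B (psum \<xi> (Suc N)) (psum \<eta> (Suc N))"
    by (simp add: mid_def B_simps scaleR_add_right scaleR_2)
  finally show ?case .
qed (simp add: B_simps)

lemma norm_area_le: "norm (area B \<xi> \<xi> N) \<le> bracket_bound * energy \<xi> N"
proof -
  define L where "L = (\<Sum>j<N. norm (\<xi> j))"
  have "norm (area B \<xi> \<xi> N) \<le> (\<Sum>j<N. bracket_bound * L * norm (\<xi> j))"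
    unfolding area_def
  proof (rule sum_norm_le)
    fix j assume "j \<in> {..<N}"
    have "norm (psum \<xi> j) \<le> (\<Sum>i<j. norm (\<xi> i))" unfolding psum_def by (rule norm_sum)
    also have "\<dots> \<le> L" unfolding L_def using \<open>j \<in> {..<N}\<close> by (intro sum_mono2) auto
    finally have "bracket_bound * norm (psum \<xi> j) * norm (\<xi> j) \<le> bracket_bound * L * norm (\<xi> j)"
      using bracket_bound_pos by (intro mult_right_mono mult_left_mono) auto
    then show "norm (B (psum \<xi> j) (\<xi> j)) \<le> bracket_bound * L * norm (\<xi> j)" using norm_B_le order_trans by blast
  qed
  also have "\<dots> = bracket_bound * L\<^sup>2" by (simp add: sum_distrib_left[symmetric] L_def power2_eq_square)
  also have "\<dots> \<le> bracket_bound * energy \<xi> N" using bracket_bound_pos length_sq_le_energy[of \<xi> N] by (simp add: L_def)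
  finally show ?thesis .
qed

text \<open>The skew operator representing the scalar form \<open>\<nu> \<bullet> B x y\<close>; it
  is the \<Lambda> of the Euler-Lagrange equation.\<close>

definition BT :: "real^'k \<Rightarrow> real^'m \<Rightarrow> real^'m" where
  "BT \<nu> x = adjoint (B x) \<nu>"

lemma BT_inner: "BT \<nu> x \<bullet> y = \<nu> \<bullet> B x y"
  unfolding BT_def using adjoint_works[OF linear_B_right, of y x \<nu>] by (simp add: inner_commute)

lemma linear_BT_left: "linear (\<lambda>\<nu>. BT \<nu> x)"
  unfolding BT_def by (rule adjoint_linear[OF linear_B_right])

lemma linear_BT: "linear (BT \<nu>)"
proof (rule linearI)
  fix x y c
  have "BT \<nu> (x + y) \<bullet> z = (BT \<nu> x + BT \<nu> y) \<bullet> z" for z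
    by (simp add: BT_inner inner_add_left inner_add_right B_simps)
  then show "BT \<nu> (x + y) = BT \<nu> x + BT \<nu> y" using vector_eq_rdot by blast
  have "BT \<nu> (c *\<^sub>R x) \<bullet> z = (c *\<^sub>R BT \<nu> x) \<bullet> z" for z
    by (simp add: BT_inner B_simps)
  then show "BT \<nu> (c *\<^sub>R x) = c *\<^sub>R BT \<nu> x" using vector_eq_rdot by blast
qed

lemma BT_skew: "BT \<nu> x \<bullet> x = 0"
  by (simp add: BT_inner)

text \<open>Moving a nearly minimal polygon against the residual \<open>\<rho>\<close> of the least squares problem
  decreases the energy to first order, but changes the area only to second order.\<close>
lemma near_minimiser_structure:
  assumes N: "N \<ge> 1" and w: "psum \<xi> N = fst w" "area B \<xi> \<xi> N = snd w"
    and near: "energy \<xi> N \<le> (cc_norm w)\<^sup>2 + \<epsilon>"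
  shows "\<exists>\<mu> \<nu> \<rho>. (\<forall>j. \<xi> j = \<mu> + BT \<nu> (mid \<xi> j) + \<rho> j) \<and> energy \<rho> N \<le> (1 + shift_cost * bracket_bound) * \<epsilon>"
proof -
  \<comment> \<open>The possible right-hand sides of the Euler-Lagrange equation; \<open>a\<close>
    is the pair of multipliers, fitted to \<open>\<xi>\<close> by least squares.\<close>
  define T where "T a j = fst a + BT (snd a) (mid \<xi> j)" for a :: "(real^'m) \<times> (real^'k)" and j
  have "linear (\<lambda>a. T a j)" for j unfolding T_def
    by (intro linear_compose_add linear_fst linear_compose[OF linear_snd linear_BT_left, unfolded o_def])
  from least_squares_normal_equation[of T, OF this, where u = \<xi> and N = N]
  obtain a where a: "\<And>b. (\<Sum>j<N. (\<xi> j - T a j) \<bullet> T b j) = 0" by blast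
  define \<rho> where "\<rho> j = \<xi> j - T a j" for j
  have a: "(\<Sum>j<N. \<rho> j \<bullet> T b j) = 0" for b using a by (simp add: \<rho>_def)
  \<comment> \<open>Orthogonality of \<open>\<rho>\<close> to all \<open>T b\<close> says exactly
    that \<open>\<rho>\<close> changes neither the horizontal endpoint nor, to first order, the
    area.\<close>
  have ps0: "psum \<rho> N = 0"
  proof -
    have "psum \<rho> N \<bullet> \<mu> = 0" for \<mu>
      using a[of "(\<mu>, 0)"] linear_0[OF linear_BT_left] by (simp add: T_def psum_def inner_sum_left)
    then show ?thesis using inner_eq_zero_iff by blast
  qed
  have mid0: "(\<Sum>j<N. B (mid \<xi> j) (\<rho> j)) = 0"
  proof -
    have "l \<bullet> (\<Sum>j<N. B (mid \<xi> j) (\<rho> j)) = 0" for l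
      using a[of "(0, l)"] by (simp add: T_def inner_sum_right BT_inner inner_commute[of "\<rho> _"])
    then show ?thesis using inner_eq_zero_iff by blast
  qed
  have "(\<Sum>j<N. \<xi> j \<bullet> \<rho> j) = (\<Sum>j<N. (\<rho> j + T a j) \<bullet> \<rho> j)" by (simp add: \<rho>_def)
  also have "\<dots> = (\<Sum>j<N. (norm (\<rho> j))\<^sup>2)"
    using a[of a] by (simp add: inner_add_left sum.distrib dot_square_norm inner_commute[of "T a _"])
  finally have in\<rho>: "(\<Sum>j<N. \<xi> j \<bullet> \<rho> j) = (\<Sum>j<N. (norm (\<rho> j))\<^sup>2)" .
  define S where "S = energy \<rho> N"
  define C1 where "C1 = 1 + shift_cost * bracket_bound"
  \<comment> \<open>The step minimising \<open>C1 * t\<^sup>2 * S - 2 * t * S\<close>, the bound on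
    the change of energy plus shift cost; its minimum is \<open>- t * S\<close>.\<close>
  define t where "t = 1 / C1"
  have C1: "C1 > 0" using shift_cost_pos bracket_bound_pos by (simp add: C1_def add_pos_pos)
  have t: "t > 0" "t * C1 = 1" using C1 by (auto simp: t_def)
  have cross: "area B \<xi> \<rho> N + area B \<rho> \<xi> N = 0" by (simp add: area_cross ps0 mid0 B_simps)
  have "area B \<xi> (\<lambda>j. (- t) *\<^sub>R \<rho> j) N + area B (\<lambda>j. (- t) *\<^sub>R \<rho> j) \<xi> N
      = (- t) *\<^sub>R (area B \<xi> \<rho> N + area B \<rho> \<xi> N)"
    using area_scaleR[of 1 \<xi> "- t" \<rho> N] area_scaleR[of "- t" \<rho> 1 \<xi> N] by (simp add: algebra_simps)
  then have ar: "area B (\<lambda>j. \<xi> j + (- t) *\<^sub>R \<rho> j) (\<lambda>j. \<xi> j + (- t) *\<^sub>R \<rho> j) N = snd w + t\<^sup>2 *\<^sub>R area B \<rho> \<rho> N"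
    unfolding area_add by (simp only: area_scaleR cross w) (simp add: power2_eq_square)
  have en: "energy (\<lambda>j. \<xi> j + (- t) *\<^sub>R \<rho> j) N = energy \<xi> N + t\<^sup>2 * S - 2 * t * S"
    unfolding energy_add energy_scaleR
    by (simp add: S_def energy_def in\<rho> sum_negf sum_distrib_left[symmetric] inner_scaleR_right)
  have "(cc_norm w)\<^sup>2 \<le> energy (\<lambda>j. \<xi> j + (- t) *\<^sub>R \<rho> j) N
      + shift_cost * norm (snd w - area B (\<lambda>j. \<xi> j + (- t) *\<^sub>R \<rho> j) (\<lambda>j. \<xi> j + (- t) *\<^sub>R \<rho> j) N)"
    by (rule cc_norm_sq_le_shifted[OF N]) (simp only: psum_add psum_scaleR ps0 w, simp)
  also have "\<dots> = energy \<xi> N + t\<^sup>2 * S - 2 * t * S + shift_cost * (t\<^sup>2 * norm (area B \<rho> \<rho> N))"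
    unfolding en ar by simp
  also have "\<dots> \<le> energy \<xi> N + t\<^sup>2 * S - 2 * t * S + shift_cost * (t\<^sup>2 * (bracket_bound * S))"
    using norm_area_le[of \<rho> N] shift_cost_pos by (simp add: S_def mult_left_mono)
  also have "\<dots> = energy \<xi> N + (t * C1) * t * S - 2 * t * S"
    by (simp add: C1_def algebra_simps power2_eq_square)
  also have "\<dots> = energy \<xi> N - t * S" by (simp add: t)
  finally have "t * S \<le> \<epsilon>" using near by linarith
  then have "S \<le> C1 * \<epsilon>" using C1 by (simp add: t_def field_simps)
  then show ?thesis
    by (intro exI[of _ "fst a"] exI[of _ "snd a"] exI[of _ \<rho>]) (auto simp: \<rho>_def T_def S_def C1_def)
qed

end

section \<open>Semiconcavity\<close>

context step2 begin

text \<open>The last bracket on the right tends to zero with \<open>\<epsilon>\<close>, whereas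
  \<open>n\<close> and \<open>c\<close> depend on the dimension alone. The surviving coefficient of
  \<open>(norm h)\<^sup>2\<close> is thus independent of \<open>w\<close> and
  \<open>h\<close>.\<close>

lemma semiconcavity_estimate:
  fixes h :: "real^'m"
  assumes \<epsilon>: "\<epsilon> > 0"
    and n: "n = 2 * DIM(real^'m) + 1" and c: "c = 2 * 4 ^ DIM(real^'m)"
  shows "(cc_norm (gmult B (- h, 0) w))\<^sup>2 + (cc_norm (gmult B (h, 0) w))\<^sup>2
    \<le> 2 * (cc_norm w)\<^sup>2 + 4 * real n ^ 3 * c\<^sup>2 * (norm h)\<^sup>2 + (2 * \<epsilon> +
      4 * shift_cost * bracket_bound * norm h * (real n * c * (sqrt ((1 + shift_cost * bracket_bound) * \<epsilon>) + sqrt (((cc_norm w)\<^sup>2 + \<epsilon>) * \<epsilon>))))"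
proof -
  \<comment> \<open>Many edges force each edge to be short, which makes midpoints and vertices
    nearly the same.\<close>
  obtain N1 where N1: "1 / \<epsilon> < real N1" using reals_Archimedean2 by blast
  obtain N \<xi> where N: "N \<ge> n + 1 + N1" "N \<ge> 1" and w: "psum \<xi> N = fst w" "area B \<xi> \<xi> N = snd w"
    and near: "energy \<xi> N \<le> (cc_norm w)\<^sup>2 + \<epsilon>"
    using cc_norm_energy_approx[OF \<epsilon>, of "n + 1 + N1" w] by blast
  have Nn: "n < N" and NN1: "N1 \<le> N" using N by auto
  have N0: "real N > 0" using N by simp
  have "1 / \<epsilon> < real N" using N1 NN1 by linarith
  then have invN: "1 / real N < \<epsilon>" using \<epsilon> N0 by (simp add: field_simps)
  obtain \<mu> \<nu> \<rho> where \<xi>: "\<And>j. \<xi> j = \<mu> + BT \<nu> (mid \<xi> j) + \<rho> j"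
    and \<rho>: "energy \<rho> N \<le> (1 + shift_cost * bracket_bound) * \<epsilon>"
    using near_minimiser_structure[OF N(2) w near] by blast
  obtain P b where P: "linear P" "\<And>x. norm (P x) = norm x"
    and Pb: "\<And>x. P x + b - x = \<mu> + BT \<nu> ((1/2) *\<^sub>R (x + (P x + b)))"
    using skew_midpoint_recursion[of "BT \<nu>" \<mu>, OF linear_BT BT_skew] by blast
  \<comment> \<open>The exact orbit with the same multipliers, that is the vertices that would
    result from \<open>\<rho> = 0\<close>.\<close>
  define X where "X k = ((\<lambda>x. P x + b) ^^ k) 0" for k
  have X0: "X 0 = 0" and XS: "X (Suc k) = P (X k) + b" for k by (simp_all add: X_def)
  obtain \<phi> :: "nat \<Rightarrow> real" where \<phi>1: "(\<Sum>j<N. \<phi> j) = 1" and \<phi>0: "(\<Sum>j<N. \<phi> j *\<^sub>R X j) = 0"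
    and \<phi>abs: "(\<Sum>j<N. \<bar>\<phi> j\<bar>) \<le> real n * c" and \<phi>sq: "real N * (\<Sum>j<N. (\<phi> j)\<^sup>2) \<le> 2 * real n ^ 3 * c\<^sup>2"
    using spread_orbit_combination[where X = X, OF P X0 XS n c Nn] by blast
  have close: "norm (psum \<xi> k - X k) \<le> (\<Sum>j<k. norm (\<rho> j))" for k
  proof (induction k)
    case (Suc k)
    interpret L: linear "BT \<nu>" by (rule linear_BT)
    have "psum \<xi> (Suc k) - X (Suc k) - (psum \<xi> k - X k) = \<xi> k - (P (X k) + b - X k)" by (simp add: XS)
    also have "\<dots> = BT \<nu> (mid \<xi> k) - BT \<nu> ((1/2) *\<^sub>R (X k + X (Suc k))) + \<rho> k"
      by (subst \<xi>) (simp add: Pb XS)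
    also have "BT \<nu> (mid \<xi> k) - BT \<nu> ((1/2) *\<^sub>R (X k + X (Suc k)))
        = BT \<nu> ((1/2) *\<^sub>R (psum \<xi> k - X k + (psum \<xi> (Suc k) - X (Suc k))))"
    proof -
      have "mid \<xi> k = (1/2) *\<^sub>R (psum \<xi> k + psum \<xi> (Suc k))"
        by (simp add: mid_def scaleR_add_right flip: scaleR_add_left)
      then show ?thesis by (simp add: L.diff[symmetric] scaleR_diff_right[symmetric] algebra_simps del: psum_Suc)
    qed
    finally have "norm (psum \<xi> (Suc k) - X (Suc k)) \<le> norm (psum \<xi> k - X k) + norm (\<rho> k)"
      by (rule midpoint_recursion_stability[OF BT_skew])
    then show ?case using Suc by simp
  qed (simp add: X0)
  define s1 where "s1 = sqrt ((1 + shift_cost * bracket_bound) * \<epsilon>)"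
  define s2 where "s2 = sqrt (((cc_norm w)\<^sup>2 + \<epsilon>) * \<epsilon>)"
  have \<rho>sum: "(\<Sum>j<N. norm (\<rho> j)) \<le> s1"
    unfolding s1_def using length_sq_le_energy[of \<rho> N] \<rho> by (intro real_le_rsqrt) linarith
  have \<xi>j: "norm (\<xi> j) \<le> s2" if "j < N" for j
  proof -
    have "(norm (\<xi> j))\<^sup>2 \<le> (\<Sum>j<N. (norm (\<xi> j))\<^sup>2)"
      using that by (intro member_le_sum) auto
    also have "\<dots> = energy \<xi> N * (1 / real N)" using N0 by (simp add: energy_def)
    also have "\<dots> \<le> ((cc_norm w)\<^sup>2 + \<epsilon>) * \<epsilon>"
      using near invN N0 \<epsilon> by (intro mult_mono) auto
    finally show ?thesis unfolding s2_def by (rule real_le_rsqrt)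
  qed
  \<comment> \<open>With orbit points in place of midpoints this mean would vanish. The difference
    is controlled by the residual (\<open>s1\<close>) and by the edge length
    (\<open>s2\<close>).\<close>
  define m where "m = (\<Sum>j<N. \<phi> j *\<^sub>R mid \<xi> j)"
  have nm: "norm m \<le> real n * c * (s1 + s2)"
  proof -
    have "m = (\<Sum>j<N. \<phi> j *\<^sub>R (mid \<xi> j - X j))"
      by (simp add: m_def scaleR_diff_right sum_subtractf \<phi>0)
    also have "norm \<dots> \<le> (\<Sum>j<N. \<bar>\<phi> j\<bar> * (s1 + s2))"
    proof (rule sum_norm_le)
      fix j assume j: "j \<in> {..<N}"
      have "mid \<xi> j - X j = (psum \<xi> j - X j) + (1/2) *\<^sub>R \<xi> j" by (simp add: mid_def)
      then have "norm (mid \<xi> j - X j) \<le> norm (psum \<xi> j - X j) + norm ((1/2) *\<^sub>R \<xi> j)"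
        by (metis norm_triangle_ineq)
      also have "norm ((1/2) *\<^sub>R \<xi> j) \<le> norm (\<xi> j)" by simp
      also have "norm (psum \<xi> j - X j) \<le> (\<Sum>j<N. norm (\<rho> j))"
        by (rule order_trans[OF close sum_mono2]) (use j in auto)
      finally have "norm (mid \<xi> j - X j) \<le> s1 + s2" using \<rho>sum \<xi>j[of j] j by auto
      then show "norm (\<phi> j *\<^sub>R (mid \<xi> j - X j)) \<le> \<bar>\<phi> j\<bar> * (s1 + s2)"
        by (simp add: mult_left_mono)
    qed
    also have "\<dots> \<le> real n * c * (s1 + s2)"
      unfolding sum_distrib_right[symmetric] using \<phi>abs \<epsilon> shift_cost_pos bracket_bound_pos
      by (intro mult_right_mono) (auto simp: s1_def s2_def)
    finally show ?thesis .
  qed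
  \<comment> \<open>The increments are all parallel to \<open>h\<close> and sum to \<open>h\<close>,
    so this variation has no area of its own.\<close>
  define \<eta> where "\<eta> j = \<phi> j *\<^sub>R h" for j
  have psn: "psum \<eta> k = (\<Sum>j<k. \<phi> j) *\<^sub>R h" for k by (simp add: psum_def \<eta>_def scaleR_sum_left)
  have arn: "area B \<eta> \<eta> N = 0" by (simp add: area_def psn, simp add: \<eta>_def B_simps)
  \<comment> \<open>Left translation by \<open>h\<close> requires precisely the vertical change
    \<open>B h (fst w)\<close>, so only the term with the small vector \<open>m\<close> is
    wrong.\<close>
  have crossn: "area B \<xi> \<eta> N + area B \<eta> \<xi> N = B h (fst w) - 2 *\<^sub>R B h m"
  proof -
    have "(\<Sum>j<N. B (mid \<xi> j) (\<eta> j)) = B m h" by (simp add: m_def \<eta>_def B_sum_left B_simps)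
    then show ?thesis using skew[of "fst w" h] skew[of m h] by (simp add: area_cross psn \<phi>1 w)
  qed
  have enn: "energy \<eta> N \<le> 2 * real n ^ 3 * c\<^sup>2 * (norm h)\<^sup>2"
  proof -
    have "energy \<eta> N = (real N * (\<Sum>j<N. (\<phi> j)\<^sup>2)) * (norm h)\<^sup>2"
      by (simp add: energy_def \<eta>_def power_mult_distrib sum_distrib_right mult.assoc)
    then show ?thesis using \<phi>sq by (simp add: mult_right_mono)
  qed
  have bound: "(cc_norm (gmult B (\<sigma> *\<^sub>R h, 0) w))\<^sup>2 \<le> energy \<xi> N + energy \<eta> N
      + 2 * \<sigma> * real N * (\<Sum>j<N. \<xi> j \<bullet> \<eta> j) + 2 * shift_cost * bracket_bound * norm h * norm m" if \<sigma>: "\<bar>\<sigma>\<bar> = 1" for \<sigma>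
  proof -
    have \<sigma>2: "\<sigma>\<^sup>2 = 1" using \<sigma> by (metis one_power2 power2_abs)
    let ?\<zeta> = "\<lambda>j. \<xi> j + \<sigma> *\<^sub>R \<eta> j"
    have "area B \<xi> (\<lambda>j. \<sigma> *\<^sub>R \<eta> j) N + area B (\<lambda>j. \<sigma> *\<^sub>R \<eta> j) \<xi> N = \<sigma> *\<^sub>R (area B \<xi> \<eta> N + area B \<eta> \<xi> N)"
      using area_scaleR[of 1 \<xi> \<sigma> \<eta> N] area_scaleR[of \<sigma> \<eta> 1 \<xi> N] by (simp add: algebra_simps)
    then have ar: "area B ?\<zeta> ?\<zeta> N = snd w + \<sigma> *\<^sub>R (B h (fst w) - 2 *\<^sub>R B h m)"
      unfolding area_add by (simp only: area_scaleR crossn w arn) simp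
    have "snd (gmult B (\<sigma> *\<^sub>R h, 0) w) - area B ?\<zeta> ?\<zeta> N = (2 * \<sigma>) *\<^sub>R B h m"
      unfolding ar by (simp add: gmult_def B_simps algebra_simps)
    then have err: "norm (snd (gmult B (\<sigma> *\<^sub>R h, 0) w) - area B ?\<zeta> ?\<zeta> N) \<le> 2 * (bracket_bound * norm h * norm m)"
      using norm_B_le[of h m] \<sigma> by (simp add: abs_mult)
    have "(cc_norm (gmult B (\<sigma> *\<^sub>R h, 0) w))\<^sup>2 \<le> energy ?\<zeta> N + shift_cost * norm (snd (gmult B (\<sigma> *\<^sub>R h, 0) w) - area B ?\<zeta> ?\<zeta> N)"
    proof (rule cc_norm_sq_le_shifted[OF N(2)])
      show "psum ?\<zeta> N = fst (gmult B (\<sigma> *\<^sub>R h, 0) w)"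
        by (simp only: psum_add psum_scaleR w psn \<phi>1) (simp add: gmult_def)
    qed
    also have "\<dots> \<le> energy ?\<zeta> N + shift_cost * (2 * (bracket_bound * norm h * norm m))"
      using err shift_cost_pos by simp
    also have "energy ?\<zeta> N = energy \<xi> N + energy \<eta> N + 2 * \<sigma> * real N * (\<Sum>j<N. \<xi> j \<bullet> \<eta> j)"
      unfolding energy_add energy_scaleR \<sigma>2 by (simp add: sum_distrib_left[symmetric] mult_ac)
    finally show ?thesis by (simp add: mult_ac)
  qed
  \<comment> \<open>The energy terms linear in \<open>\<sigma>\<close> cancel between the two
    signs.\<close>
  have "(cc_norm (gmult B (- h, 0) w))\<^sup>2 + (cc_norm (gmult B (h, 0) w))\<^sup>2
      \<le> 2 * energy \<xi> N + 2 * energy \<eta> N + 4 * shift_cost * bracket_bound * norm h * norm m"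
    using bound[of 1] bound[of "-1"] by simp
  also have "4 * shift_cost * bracket_bound * norm h * norm m \<le> 4 * shift_cost * bracket_bound * norm h * (real n * c * (s1 + s2))"
    using nm shift_cost_pos bracket_bound_pos by (intro mult_left_mono) auto
  finally show ?thesis using near enn unfolding s1_def s2_def by linarith
qed

lemma cc_norm_sq_semiconcave:
  "\<exists>C\<ge>0. \<forall>w h. (cc_norm (gmult B (- h, 0) w))\<^sup>2 + (cc_norm (gmult B (h, 0) w))\<^sup>2 \<le> 2 * (cc_norm w)\<^sup>2 + C * (norm h)\<^sup>2"
proof -
  define n where "n = 2 * DIM(real^'m) + 1"
  define c :: real where "c = 2 * 4 ^ DIM(real^'m)"
  have "(cc_norm (gmult B (- h, 0) w))\<^sup>2 + (cc_norm (gmult B (h, 0) w))\<^sup>2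
      \<le> 2 * (cc_norm w)\<^sup>2 + (4 * real n ^ 3 * c\<^sup>2) * (norm h)\<^sup>2" for w h
  proof (rule tendsto_lowerbound)
    let ?E = "\<lambda>\<epsilon>. 2 * (cc_norm w)\<^sup>2 + 4 * real n ^ 3 * c\<^sup>2 * (norm h)\<^sup>2 + (2 * \<epsilon> +
      4 * shift_cost * bracket_bound * norm h * (real n * c * (sqrt ((1 + shift_cost * bracket_bound) * \<epsilon>) + sqrt (((cc_norm w)\<^sup>2 + \<epsilon>) * \<epsilon>))))"
    have "(?E \<longlongrightarrow> ?E 0) (at_right 0)" by (intro tendsto_intros)
    then show "(?E \<longlongrightarrow> 2 * (cc_norm w)\<^sup>2 + 4 * real n ^ 3 * c\<^sup>2 * (norm h)\<^sup>2) (at_right 0)" by simp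
    show "\<forall>\<^sub>F \<epsilon> in at_right 0. (cc_norm (gmult B (- h, 0) w))\<^sup>2 + (cc_norm (gmult B (h, 0) w))\<^sup>2 \<le> ?E \<epsilon>"
      unfolding eventually_at_right_field
      by (intro exI[of _ 1]) (auto intro!: semiconcavity_estimate n_def c_def)
  qed simp
  then show ?thesis by (intro exI[of _ "4 * real n ^ 3 * c\<^sup>2"]) (auto simp: c_def)
qed

lemma gmult_uminus: "- gmult B p q = gmult B (- q) (- p)"
  using skew[of "fst p" "fst q"] by (simp add: gmult_def B_simps prod_eq_iff)

text \<open>Moving the base point on the right by \<open>h\<close> moves the relative position on
  the left by the inverse of \<open>h\<close>, the form in which semiconcavity was proved.\<close>

lemma cc_dist_gmult: "cc_dist B (gmult B p (h, 0)) q = cc_norm (gmult B (- h, 0) (gmult B (- p) q))"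
  by (simp add: cc_dist_eq gmult_uminus gmult_assoc)

section \<open>The Hopf-Lax infimum\<close>

context
  fixes g :: "(real^'m) \<times> (real^'k) \<Rightarrow> real" and C t :: real
  assumes C: "C > 0" and t: "t > 0" and growth: "\<And>p. g p \<ge> - C * (1 + cc_dist B p 0)"
begin

lemma growth_cc_norm: "g q \<ge> - C * (1 + cc_norm p + cc_dist B p q)"
proof -
  have "cc_dist B q 0 = cc_norm q" by (simp add: cc_dist_eq cc_norm_minus)
  also have "\<dots> = cc_norm (gmult B p (gmult B (- p) q))" by (simp add: gmult_inverse)
  also have "\<dots> \<le> cc_norm p + cc_dist B p q" unfolding cc_dist_eq by (rule cc_norm_triangle)
  finally have "C * (1 + cc_dist B q 0) \<le> C * (1 + cc_norm p + cc_dist B p q)" using C by simp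
  then show ?thesis using growth[of q] by linarith
qed

text \<open>Completing the square shows that the quadratic penalty beats the linear decay of
  \<open>g\<close>, so the infimum is a genuine one.\<close>

lemma hopf_lax_bdd: "bdd_below (range (\<lambda>q. g q + (cc_dist B p q)\<^sup>2 / (2 * t)))"
proof (rule bdd_belowI2)
  fix q
  define r where "r = cc_dist B p q"
  have "0 \<le> (r - C * t)\<^sup>2 / (2 * t)" using t by simp
  also have "\<dots> = r\<^sup>2 / (2 * t) - C * r + C\<^sup>2 * t / 2"
    using t by (simp add: power2_diff field_simps power2_eq_square)
  finally show "- C * (1 + cc_norm p) - C\<^sup>2 * t / 2 \<le> g q + (cc_dist B p q)\<^sup>2 / (2 * t)"
    using growth_cc_norm[of p q] by (simp add: r_def algebra_simps)
qed

lemma hopf_lax_le: "hopf_lax B g t p \<le> g q + (cc_dist B p q)\<^sup>2 / (2 * t)"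
  unfolding hopf_lax_def by (rule cINF_lower[OF hopf_lax_bdd]) simp

lemma hopf_lax_greatest: "(\<And>q. a \<le> g q + (cc_dist B p q)\<^sup>2 / (2 * t)) \<Longrightarrow> a \<le> hopf_lax B g t p"
  unfolding hopf_lax_def by (rule cINF_greatest) auto

text \<open>Competitors \<open>q\<close> far from \<open>p'\<close> already have values above
  \<open>hopf_lax B g t p\<close>. For the others the squared distance changes by at most
  \<open>2 * R + 1\<close> times the distance from \<open>p\<close> to \<open>p'\<close>.\<close>

lemma hopf_lax_local_bound:
  "\<exists>K>0. \<forall>p'. cc_dist B p p' \<le> 1 \<longrightarrow> hopf_lax B g t p - K * cc_dist B p p' \<le> hopf_lax B g t p'"
proof -
  define u where "u = hopf_lax B g t p"
  \<comment> \<open>Beyond this radius the penalty exceeds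
    \<open>C * r' + C * (2 + cc_norm p) + \<bar>u\<bar>\<close>, which absorbs the lower bound on
    \<open>g\<close> and still leaves \<open>\<bar>u\<bar>\<close>.\<close>
  define R where "R = max 1 (2 * t * (C + (C * (2 + cc_norm p) + \<bar>u\<bar>)))"
  define K where "K = (2 * R + 1) / (2 * t)"
  have R1: "R \<ge> 1" by (simp add: R_def)
  have "u - K * cc_dist B p p' \<le> hopf_lax B g t p'" if d1: "cc_dist B p p' \<le> 1" for p'
  proof (rule hopf_lax_greatest)
    fix q
    define \<delta> where "\<delta> = cc_dist B p p'"
    define r where "r = cc_dist B p q"
    define r' where "r' = cc_dist B p' q"
    have \<delta>0: "\<delta> \<ge> 0" "\<delta> \<le> 1" and r0: "r \<ge> 0" "r' \<ge> 0"
      using d1 by (auto simp: \<delta>_def r_def r'_def cc_dist_nonneg)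
    have "gmult B (gmult B (- p) p') (gmult B (- p') q) = gmult B (- p) q"
      by (simp add: gmult_assoc gmult_inverse)
    then have rr': "r \<le> \<delta> + r'"
      unfolding r_def r'_def \<delta>_def cc_dist_eq using cc_norm_triangle by metis
    have "u - K * \<delta> \<le> g q + r'\<^sup>2 / (2 * t)"
    proof (cases "r' \<le> R")
      case True
      have "r\<^sup>2 \<le> (\<delta> + r')\<^sup>2" using rr' r0 by (intro power_mono)
      also have "\<dots> = r'\<^sup>2 + \<delta> * (2 * r' + \<delta>)" by (simp add: power2_eq_square algebra_simps)
      also have "\<dots> \<le> r'\<^sup>2 + \<delta> * (2 * R + 1)" using True \<delta>0 by (intro add_left_mono mult_left_mono) auto
      finally have "r\<^sup>2 / (2 * t) \<le> r'\<^sup>2 / (2 * t) + K * \<delta>"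
        using t by (simp add: K_def field_simps)
      moreover have "u \<le> g q + r\<^sup>2 / (2 * t)" unfolding u_def r_def by (rule hopf_lax_le)
      ultimately show ?thesis by linarith
    next
      case False
      define b where "b = C * (2 + cc_norm p) + \<bar>u\<bar>"
      have b0: "b \<ge> 0" using C cc_norm_nonneg[of p] by (simp add: b_def)
      have "2 * t * (C + b) \<le> r'" using False by (simp add: R_def b_def)
      then have "C + b \<le> r' / (2 * t)" using t by (simp add: field_simps)
      then have "(C + b) * r' \<le> (r' / (2 * t)) * r'" using r0 by (intro mult_right_mono)
      moreover have "b * 1 \<le> b * r'" using False R1 b0 by (intro mult_left_mono) auto
      ultimately have "C * r' + b \<le> r'\<^sup>2 / (2 * t)" by (simp add: power2_eq_square algebra_simps)
      moreover have "g q \<ge> - C * (1 + cc_norm p + r)" unfolding r_def by (rule growth_cc_norm)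
      moreover have "C * (1 + cc_norm p + r) \<le> C * (2 + cc_norm p + r')" using C rr' \<delta>0 by (intro mult_left_mono) auto
      moreover have "0 \<le> K * \<delta>" using \<delta>0 R1 t by (simp add: K_def)
      ultimately show ?thesis unfolding b_def by (simp add: algebra_simps)
    qed
    then show "u - K * cc_dist B p p' \<le> g q + (cc_dist B p' q)\<^sup>2 / (2 * t)"
      by (simp only: \<delta>_def r'_def)
  qed
  moreover have "K > 0" using R1 t by (simp add: K_def)
  ultimately show ?thesis unfolding u_def by blast
qed

lemma lsc_hopf_lax: "lsc (hopf_lax B g t)"
  unfolding lsc_def
proof (intro allI Topological_Spaces.openI)
  fix a p assume "p \<in> {x. a < hopf_lax B g t x}"
  then have pa: "a < hopf_lax B g t p" by simp
  obtain K where K: "K > 0" "\<And>p'. cc_dist B p p' \<le> 1 \<Longrightarrow> hopf_lax B g t p - K * cc_dist B p p' \<le> hopf_lax B g t p'"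
    using hopf_lax_local_bound by blast
  define s where "s = min 1 ((hopf_lax B g t p - a) / (2 * K))"
  have s: "s > 0" "s \<le> 1" using pa K by (auto simp: s_def)
  have "s \<le> (hopf_lax B g t p - a) / (2 * K)" by (simp add: s_def)
  then have sK: "2 * K * s \<le> hopf_lax B g t p - a" using K(1) by (simp add: field_simps)
  \<comment> \<open>A Euclidean-continuous majorant of the squared distance from \<open>p\<close>,
    vanishing at \<open>p\<close>. It turns the bound in terms of \<open>cc_dist\<close> into a
    statement about open sets.\<close>
  define f where "f p' = (norm (fst p' - fst p))\<^sup>2 + shift_cost * norm (snd p' - snd p - B (fst p) (fst p'))" for p'
  have f: "(cc_dist B p p')\<^sup>2 \<le> f p'" for p'
    using cc_norm_sq_le[of "gmult B (- p) p'"] by (simp add: cc_dist_eq f_def gmult_def B_simps algebra_simps)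
  have "continuous_on UNIV f" unfolding f_def
    by (intro continuous_intros bounded_linear.continuous_on[where g = fst and f = "B (fst p)"])
       (simp_all add: linear_B_right linear_conv_bounded_linear[symmetric])
  then have "open {p'. f p' < s\<^sup>2}" by (intro open_Collect_less continuous_intros) auto
  moreover have "p \<in> {p'. f p' < s\<^sup>2}" using s by (simp add: f_def)
  moreover have "{p'. f p' < s\<^sup>2} \<subseteq> {x. a < hopf_lax B g t x}"
  proof
    fix p' assume "p' \<in> {p'. f p' < s\<^sup>2}"
    then have "(cc_dist B p p')\<^sup>2 < s\<^sup>2" using f[of p'] by simp
    then have lt: "cc_dist B p p' < s" using s by (simp add: power2_less_imp_less)
    then have "K * cc_dist B p p' \<le> K * s" using K(1) by simp
    moreover have "K * s > 0" using K s by simp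
    moreover have "hopf_lax B g t p - K * cc_dist B p p' \<le> hopf_lax B g t p'" using lt s by (intro K) simp
    ultimately have "a < hopf_lax B g t p'" using sK by linarith
    then show "p' \<in> {x. a < hopf_lax B g t x}" by simp
  qed
  ultimately show "\<exists>T. open T \<and> p \<in> T \<and> T \<subseteq> {x. a < hopf_lax B g t x}" by blast
qed

text \<open>Any competitor \<open>q\<close> for \<open>p\<close> is also used for both translated
  points, so \<open>g q\<close> cancels and only the squared distances are compared. Afterwards the
  infimum over \<open>q\<close> is taken.\<close>

lemma h_semiconcave_hopf_lax: "h_semiconcave B (hopf_lax B g t)"
proof -
  obtain D where D: "D \<ge> 0" "\<And>w h. (cc_norm (gmult B (- h, 0) w))\<^sup>2 + (cc_norm (gmult B (h, 0) w))\<^sup>2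
      \<le> 2 * (cc_norm w)\<^sup>2 + D * (norm h)\<^sup>2"
    using cc_norm_sq_semiconcave by blast
  have "hopf_lax B g t (gmult B p (h, 0)) + hopf_lax B g t (gmult B p (- h, 0)) - 2 * hopf_lax B g t p
      \<le> D / (2 * t) * (norm h)\<^sup>2" for p h
  proof -
    let ?a = "hopf_lax B g t (gmult B p (h, 0)) + hopf_lax B g t (gmult B p (- h, 0)) - D / (2 * t) * (norm h)\<^sup>2"
    have "?a / 2 \<le> hopf_lax B g t p"
    proof (rule hopf_lax_greatest)
      fix q
      let ?w = "gmult B (- p) q"
      have "?a \<le> 2 * g q + ((cc_norm (gmult B (- h, 0) ?w))\<^sup>2 + (cc_norm (gmult B (h, 0) ?w))\<^sup>2) / (2 * t) - D / (2 * t) * (norm h)\<^sup>2"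
        using hopf_lax_le[of "gmult B p (h, 0)" q] hopf_lax_le[of "gmult B p (- h, 0)" q]
        by (simp add: cc_dist_gmult add_divide_distrib)
      also have "((cc_norm (gmult B (- h, 0) ?w))\<^sup>2 + (cc_norm (gmult B (h, 0) ?w))\<^sup>2) / (2 * t)
          \<le> (2 * (cc_norm ?w)\<^sup>2 + D * (norm h)\<^sup>2) / (2 * t)"
        using D(2) t by (intro divide_right_mono) auto
      finally have "?a \<le> 2 * (g q + (cc_norm ?w)\<^sup>2 / (2 * t))" by (simp add: add_divide_distrib)
      then show "?a / 2 \<le> g q + (cc_dist B p q)\<^sup>2 / (2 * t)" by (simp add: cc_dist_eq)
    qed
    then show ?thesis by simp
  qed
  then show ?thesis unfolding h_semiconcave_def using lsc_hopf_lax D(1) t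
    by (auto intro!: exI[of _ "D / (2 * t)"])
qed

end

end

theorem theorem6p2:
  fixes B :: "real^'m \<Rightarrow> real^'m \<Rightarrow> real^'k"
    and g :: "(real^'m) \<times> (real^'k) \<Rightarrow> real"
    and C :: real
  assumes "step2_carnot B"
    and "lsc g"
    and "C > 0"
    and "\<forall>p. g p \<ge> - C * (1 + cc_dist B p 0)"
  shows "\<forall>t>0. h_semiconcave B (hopf_lax B g t)"
proof -
  interpret step2 B by unfold_locales (rule assms(1))
  show ?thesis using h_semiconcave_hopf_lax[OF assms(3)] assms(4) by blast
qed

end
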